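(* Let $H$ be a Hopf algebra with invertible antipode, $B=A^{\mathrm{co}H}\subseteq A$ a quantum principal bundle and $\Omega^\bullet(A)$ a complete calculus on it (with respect to the maximal prolongation $\Omega^\bullet(H)$ of a bicovariant first order differential calculus on $H$). Let $F^\bullet\in\mathfrak{aut}_v^\bullet(B,A)$ be a graded vertical automorphism and $s\colon\Lambda^1\to\Omega^1(A)$ a connection $1$-form, and define $F^\bullet\rhd s:=F^\bullet\circ s\colon\Lambda^1\to\Omega^1(A)$. Then $F^\bullet\rhd s$ is a connection $1$-form with curvature $$\mathrm{R}_{F^\bullet\rhd s}(h)=\mathrm{d}F^\bullet(s(\varpi(h)))+F^\bullet(s(\varpi(\pi_\varepsilon(h_1))))\wedge F^\bullet(s(\varpi(\pi_\varepsilon(h_2))))\qquad\text{for all }h\in H^+.$$ In particular, $F^\bullet\circ\mathrm{R}_s=\mathrm{R}_{F^\bullet\rhd s}$ if $F^\bullet$ is a morphism of differential graded algebras. Moreover, $\mathfrak{aut}_v^\bullet(B,A)\times\mathrm{con}(B,A)\to\mathrm{con}(B,A)$, $(F^\bullet,s)\mapsto F^\bullet\rhd s$, is a group action.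
   Context: Everything is over a field $\Bbbk$, $\otimes=\otimes_\Bbbk$; algebras are associative and unital. $H$ is a Hopf algebra with coproduct $\Delta(h)=h_1\otimes h_2$ (Sweedler notation), counit $\varepsilon$ and antipode $S$, assumed invertible as a linear map. $H^+:=\ker\varepsilon$ and $\pi_\varepsilon\colon H\to H^+$, $\pi_\varepsilon(h)=h-\varepsilon(h)1$. A right $H$-comodule algebra is an algebra $A$ with a right $H$-coaction $\Delta_A\colon A\to A\otimes H$, $\Delta_A(a)=a_0\otimes a_1$, which is an algebra morphism; $B:=A^{\mathrm{co}H}:=\{a\in A\mid\Delta_A(a)=a\otimes 1\}$. $B\subseteq A$ is a Hopf--Galois extension if $\chi\colon A\otimes_BA\to A\otimes H$, $\chi(a\otimes_Ba')=aa'_0\otimes a'_1$, is bijective, and a quantum principal bundle if moreover $A$ is a faithfully flat right $B$-module. A differential calculus on an algebra $A$ is a differential graded algebra $\Omega^\bullet(A)=\bigoplus_{n\ge0}\Omega^n(A)$ (product $\wedge$, differential $\mathrm{d}$ of degree $1$, $\mathrm{d}^2=0$, graded Leibniz rule) with $\Omega^0(A)=A$ and $\Omega^n(A)=\mathrm{span}_\Bbbk\{a^0\mathrm{d}a^1\wedge\ldots\wedge\mathrm{d}a^n\}$. A first order differential calculus (FODC) $(\Omega^1(A),\mathrm{d})$ is an $A$-bimodule with a $\Bbbk$-linear map $\mathrm{d}\colon A\to\Omega^1(A)$ satisfying the Leibniz rule and $\Omega^1(A)=A\,\mathrm{d}A$. Its maximal prolongation is the differential calculus obtained as the quotient of the tensor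 algebra of $\Omega^1(A)$ over $A$ by the ideal generated by all $\sum_i\mathrm{d}a^i\otimes_A\mathrm{d}b^i$ with $\sum_ia^i\mathrm{d}b^i=0$. A FODC on $H$ is bicovariant if the left and right coactions of $H$ on itself given by $\Delta$ extend to coactions on $\Omega^1(H)$ making it an $H$-bicomodule with coactions compatible with the $H$-bimodule structure and with $\mathrm{d}$ bicolinear. Fix a bicovariant FODC on $H$ with maximal prolongation $\Omega^\bullet(H)$. $\Lambda^1:={}^{\mathrm{co}H}\Omega^1(H)$ is the space of left coinvariant $1$-forms, and the Cartan--Maurer form is the surjection $\varpi\colon H^+\to\Lambda^1$, $\varpi(h)=S(h_1)\mathrm{d}h_2$. A differential calculus $\Omega^\bullet(A)$ on a quantum principal bundle $B=A^{\mathrm{co}H}\subseteq A$ is complete if $\Delta_A$ extends to a (necessarily unique) morphism of differential graded algebras $\Delta_A^\bullet\colon\Omega^\bullet(A)\to\Omega^\bullet(A)\otimes\Omega^\bullet(H)$ (tensor product of graded algebras with the Koszul sign rule). Then $\Omega^1(A)$ has the right $H$-coaction $\Delta_{\Omega^1(A)}\colon\Omega^1(A)\to\Omega^1(A)\otimes H$, the component of $\Delta_A^\bullet$ in $\Omega^1(A)\otimes H$, and there is a well-defined map $\pi_v\colon\Omega^1(A)\to A\otimes\Lambda^1$, $\pi_v(a\,\mathrm{d}a')=aa'_0\otimes S(a'_1)\mathrm{d}a'_2$. The basic forms are $\Omega^\bullet(B):=\{\omega\in\Omega^\bullet(A)\mid\Delta_A^\bullet(\omega)=\omega\otimes1\}$.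 A connection $1$-form is a $\Bbbk$-linear map $s\colon\Lambda^1\to\Omega^1(A)$ such that $\Delta_{\Omega^1(A)}(s(\varpi(h)))=s(\varpi(\pi_\varepsilon(h_2)))\otimes S(h_1)h_3$ for all $h\in H^+$ and $\pi_v(s(\vartheta))=1_A\otimes\vartheta$ for all $\vartheta\in\Lambda^1$. The set of connection $1$-forms is $\mathrm{con}(B,A)$. The curvature of a connection $1$-form $s$ is the map $\mathrm{R}_s\colon H^+\to\Omega^2(A)$, $\mathrm{R}_s(h):=\mathrm{d}s(\varpi(h))+s(\varpi(\pi_\varepsilon(h_1)))\wedge s(\varpi(\pi_\varepsilon(h_2)))$. $\mathfrak{aut}_v^\bullet(B,A)$ (graded vertical automorphisms) is the set of $\Bbbk$-linear maps $F^\bullet\colon\Omega^\bullet(A)\to\Omega^\bullet(A)$ of degree zero which are left $\Omega^\bullet(B)$-linear, bijective, satisfy $F^0(1)=1$ (where $F^0$ is the degree $0$ component), and satisfy $\Delta_A^\bullet\circ F^\bullet=(F^\bullet\otimes\mathrm{id})\circ\Delta_A^\bullet$. It is equipped with the group structure given by the opposite composition $F^\bullet\otimes G^\bullet\mapsto G^\bullet\circ F^\bullet$, with group inverse the $\Bbbk$-linear inverse. *)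

theory Defs
  imports Complex_Main "HOL-Library.Poly_Mapping" "HOL-Library.FuncSet"
    "HOL-Algebra.Module" "HOL-Algebra.Group_Action"
begin

text \<open>
  Algebras are types of sort \<open>{ring, monoid_mult}\<close> (so that the zero algebra is not excluded)
  together with a scalar multiplication by the field \<open>'k\<close>.
\<close>

definition algebra_scale :: "('k::field \<Rightarrow> 'a \<Rightarrow> 'a::{ring,monoid_mult}) \<Rightarrow> bool" where
  "algebra_scale s \<longleftrightarrow> vector_space s \<and>
     (\<forall>c x y. s c (x * y) = s c x * y \<and> s c (x * y) = x * s c y)"

section \<open>Free vector spaces and quotients\<close>

definition pm_scale :: "'k::field \<Rightarrow> ('p \<Rightarrow>\<^sub>0 'k) \<Rightarrow> ('p \<Rightarrow>\<^sub>0 'k)" where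
  "pm_scale c = Poly_Mapping.map ((*) c)"

abbreviation gen :: "'p \<Rightarrow> ('p \<Rightarrow>\<^sub>0 'k::field)" where
  "gen p \<equiv> Poly_Mapping.single p 1"

lemma lookup_pm_scale [simp]:
  "Poly_Mapping.lookup (pm_scale c x) p = c * Poly_Mapping.lookup x p"
  by (simp add: pm_scale_def Poly_Mapping.map.rep_eq when_def)

lemma vector_space_pm_scale: "vector_space pm_scale"
  by unfold_locales (auto intro!: poly_mapping_eqI simp: lookup_add algebra_simps)

text \<open>
  The quotient of the free vector space by a subspace \<open>U\<close> is modelled by a linear complement of
  \<open>U\<close>: \<open>reduce U\<close> is an idempotent linear map with kernel \<open>U\<close>, chosen once and for all, and the
  class of \<open>x\<close> is represented by \<open>reduce U x\<close>.  Hence \<open>range (reduce U)\<close> is the quotient.  Its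
  elements are formal sums, so it is closed under the addition of the type and can be tensored again.
\<close>

definition reduce :: "('p \<Rightarrow>\<^sub>0 'k::field) set \<Rightarrow> ('p \<Rightarrow>\<^sub>0 'k) \<Rightarrow> ('p \<Rightarrow>\<^sub>0 'k)" where
  "reduce U = (SOME f. Vector_Spaces.linear pm_scale pm_scale f \<and>
      (\<forall>x. f (f x) = f x) \<and> (\<forall>x. f x = 0 \<longleftrightarrow> x \<in> U))"

lemma reduce_exists:
  fixes U :: "('p \<Rightarrow>\<^sub>0 'k::field) set"
  assumes "module.subspace pm_scale U"
  shows "\<exists>f. Vector_Spaces.linear pm_scale pm_scale f \<and>
      (\<forall>x. f (f x) = f x) \<and> (\<forall>x. f x = 0 \<longleftrightarrow> x \<in> U)"
proof -
  interpret V: vector_space "pm_scale :: 'k \<Rightarrow> ('p \<Rightarrow>\<^sub>0 'k) \<Rightarrow> _" by (rule vector_space_pm_scale)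
  interpret P: vector_space_pair "pm_scale :: 'k \<Rightarrow> ('p \<Rightarrow>\<^sub>0 'k) \<Rightarrow> _"
      "pm_scale :: 'k \<Rightarrow> ('p \<Rightarrow>\<^sub>0 'k) \<Rightarrow> _" by unfold_locales
  obtain g where g: "Vector_Spaces.linear pm_scale pm_scale g" "range g \<subseteq> U" "\<And>x. x \<in> U \<Longrightarrow> g x = x"
    using P.linear_exists_left_inverse_on[of "\<lambda>x. x" U] assms V.linear_ident by auto
  interpret g: Vector_Spaces.linear pm_scale pm_scale g by (rule g(1))
  let ?f = "\<lambda>x. x - g x"
  have "Vector_Spaces.linear pm_scale pm_scale ?f"
    by (intro P.linear_compose_sub V.linear_ident g(1))
  moreover have "?f (?f x) = ?f x" for x
    using g(2,3) by (auto simp: g.diff)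
  moreover have "?f x = 0 \<longleftrightarrow> x \<in> U" for x
    using g(2,3) by (metis eq_iff_diff_eq_0 rangeI subsetD)
  ultimately show ?thesis by blast
qed

lemma reduce:
  fixes U :: "('p \<Rightarrow>\<^sub>0 'k::field) set"
  assumes "module.subspace pm_scale U"
  shows "Vector_Spaces.linear pm_scale pm_scale (reduce U)"
    and "reduce U (reduce U x) = reduce U x"
    and "reduce U x = 0 \<longleftrightarrow> x \<in> U"
  using someI_ex[OF reduce_exists[OF assms]] unfolding reduce_def by blast+

section \<open>Tensor products\<close>

type_synonym ('k, 'a, 'b) tensor = "('a \<times> 'b) \<Rightarrow>\<^sub>0 'k"

definition tens_rel ::
  "('k::field \<Rightarrow> 'a::ab_group_add \<Rightarrow> 'a) \<Rightarrow> ('k \<Rightarrow> 'b::ab_group_add \<Rightarrow> 'b) \<Rightarrow> ('k,'a,'b) tensor set" where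
  "tens_rel s t = module.span pm_scale
     ({gen (x + x', y) - gen (x, y) - gen (x', y) | x x' y. True} \<union>
      {gen (x, y + y') - gen (x, y) - gen (x, y') | x y y'. True} \<union>
      {gen (s c x, y) - pm_scale c (gen (x, y)) | c x y. True} \<union>
      {gen (x, t c y) - pm_scale c (gen (x, y)) | c x y. True})"

definition tens ::
  "('k::field \<Rightarrow> 'a::ab_group_add \<Rightarrow> 'a) \<Rightarrow> ('k \<Rightarrow> 'b::ab_group_add \<Rightarrow> 'b) \<Rightarrow> 'a \<Rightarrow> 'b \<Rightarrow> ('k,'a,'b) tensor" where
  "tens s t x y = reduce (tens_rel s t) (gen (x, y))"

text \<open>
  For subspaces \<open>X\<close>, \<open>Y\<close>, the tensor product of \<open>X\<close> and \<open>Y\<close>, as a subspace of the tensor product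
  of the ambient spaces (over a field, the canonical map is injective).
\<close>

definition tens_space ::
  "('k::field \<Rightarrow> 'a::ab_group_add \<Rightarrow> 'a) \<Rightarrow> ('k \<Rightarrow> 'b::ab_group_add \<Rightarrow> 'b) \<Rightarrow> 'a set \<Rightarrow> 'b set \<Rightarrow> ('k,'a,'b) tensor set" where
  "tens_space s t X Y = module.span pm_scale {tens s t x y | x y. x \<in> X \<and> y \<in> Y}"

text \<open>
  The linear map to a space with scalar multiplication \<open>r\<close> that is induced by a bilinear map \<open>f\<close>;
  see \<open>tlift_tens\<close> below.  Sweedler notation is rendered by it:
  \<open>tlift r (\<lambda>x y. f x y) (\<Delta> h)\<close> stands for the sum \<open>f(h\<^sub>1, h\<^sub>2)\<close>.
\<close>

definition tlift ::
  "('k::field \<Rightarrow> 'c::ab_group_add \<Rightarrow> 'c) \<Rightarrow> ('a \<Rightarrow> 'b \<Rightarrow> 'c) \<Rightarrow> ('k,'a,'b) tensor \<Rightarrow> 'c" where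
  "tlift r f T = (\<Sum>p\<in>Poly_Mapping.keys T. r (Poly_Mapping.lookup T p) (f (fst p) (snd p)))"

definition tmap ::
  "('k::field \<Rightarrow> 'c::ab_group_add \<Rightarrow> 'c) \<Rightarrow> ('k \<Rightarrow> 'd::ab_group_add \<Rightarrow> 'd) \<Rightarrow>
   ('a \<Rightarrow> 'c) \<Rightarrow> ('b \<Rightarrow> 'd) \<Rightarrow> ('k,'a,'b) tensor \<Rightarrow> ('k,'c,'d) tensor" where
  "tmap s t f g = tlift pm_scale (\<lambda>x y. tens s t (f x) (g y))"

definition tmult ::
  "('k::field \<Rightarrow> 'a::{ring,monoid_mult} \<Rightarrow> 'a) \<Rightarrow> ('k \<Rightarrow> 'b::{ring,monoid_mult} \<Rightarrow> 'b) \<Rightarrow>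
   ('k,'a,'b) tensor \<Rightarrow> ('k,'a,'b) tensor \<Rightarrow> ('k,'a,'b) tensor" where
  "tmult s t T T' =
     tlift pm_scale (\<lambda>x y. tlift pm_scale (\<lambda>x' y'. tens s t (x * x') (y * y')) T') T"

definition bilinear_map ::
  "('k::field \<Rightarrow> 'a::ab_group_add \<Rightarrow> 'a) \<Rightarrow> ('k \<Rightarrow> 'b::ab_group_add \<Rightarrow> 'b) \<Rightarrow>
   ('k \<Rightarrow> 'c::ab_group_add \<Rightarrow> 'c) \<Rightarrow> ('a \<Rightarrow> 'b \<Rightarrow> 'c) \<Rightarrow> bool" where
  "bilinear_map s t r f \<longleftrightarrow> (\<forall>x. Vector_Spaces.linear t r (f x)) \<and>
     (\<forall>y. Vector_Spaces.linear s r (\<lambda>x. f x y))"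

lemma subspace_tens_rel: "module.subspace pm_scale (tens_rel s t)"
proof -
  interpret vector_space pm_scale by (rule vector_space_pm_scale)
  show ?thesis unfolding tens_rel_def by (rule subspace_span)
qed

lemma tlift_superset:
  assumes "vector_space r" "finite S" "Poly_Mapping.keys T \<subseteq> S"
  shows "tlift r f T = (\<Sum>p\<in>S. r (Poly_Mapping.lookup T p) (f (fst p) (snd p)))"
proof -
  interpret vector_space r by fact
  show ?thesis unfolding tlift_def
    by (rule sum.mono_neutral_left) (use assms(2,3) in \<open>auto simp: in_keys_iff\<close>)
qed

lemma linear_tlift:
  assumes "vector_space r"
  shows "Vector_Spaces.linear pm_scale r (tlift r f)"
proof -
  interpret R: vector_space r by fact
  interpret V: vector_space pm_scale by (rule vector_space_pm_scale)
  have add: "tlift r f (x + y) = tlift r f x + tlift r f y" for x y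
    using Poly_Mapping.keys_add[of x y]
    by (simp add: tlift_superset[OF assms, where S = "Poly_Mapping.keys x \<union> Poly_Mapping.keys y"]
        lookup_add R.scale_left_distrib sum.distrib)
  have scale: "tlift r f (pm_scale c x) = r c (tlift r f x)" for c x
  proof -
    have "Poly_Mapping.keys (pm_scale c x) \<subseteq> Poly_Mapping.keys x" by (auto simp: in_keys_iff)
    then show ?thesis
      by (simp add: tlift_superset[OF assms, where S = "Poly_Mapping.keys x"] R.scale_sum_right)
  qed
  show ?thesis
    unfolding Vector_Spaces.linear_iff using add scale assms vector_space_pm_scale by blast
qed

lemma tlift_gen:
  assumes "vector_space r"
  shows "tlift r f (gen (x, y)) = f x y"
proof -
  interpret vector_space r by fact
  show ?thesis by (simp add: tlift_def)
qed

lemma tlift_reduce: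
  fixes s :: "'k::field \<Rightarrow> 'a::ab_group_add \<Rightarrow> 'a" and t :: "'k \<Rightarrow> 'b::ab_group_add \<Rightarrow> 'b"
  assumes r: "vector_space r" and f: "bilinear_map s t r f"
  shows "tlift r f (reduce (tens_rel s t) x) = tlift r f x"
proof -
  interpret R: vector_space r by fact
  interpret V: vector_space "pm_scale :: 'k \<Rightarrow> ('k,'a,'b) tensor \<Rightarrow> _" by (rule vector_space_pm_scale)
  interpret L: Vector_Spaces.linear pm_scale r "tlift r f" by (rule linear_tlift[OF r])
  interpret Q: Vector_Spaces.linear pm_scale pm_scale "reduce (tens_rel s t)"
    by (rule reduce(1)[OF subspace_tens_rel])
  have f': "f (x + x') y = f x y + f x' y" "f x (y + y') = f x y + f x y'"
    "f (s c x) y = r c (f x y)" "f x (t c y) = r c (f x y)" for x x' y y' c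
    using f by (auto simp: bilinear_map_def Vector_Spaces.linear_iff)
  have zero: "tlift r f z = 0" if "z \<in> tens_rel s t" for z
    using that unfolding tens_rel_def
  proof (induction rule: V.span_induct_alt)
    case base then show ?case by (rule L.zero)
  next
    case (step c u v)
    then show ?case
      by (auto simp: L.add L.diff L.scale tlift_gen[OF r] f')
  qed
  have "reduce (tens_rel s t) (x - reduce (tens_rel s t) x) = 0"
    by (simp add: Q.diff reduce(2)[OF subspace_tens_rel])
  then have "tlift r f (x - reduce (tens_rel s t) x) = 0"
    using zero reduce(3)[OF subspace_tens_rel] by blast
  then show ?thesis by (simp add: L.diff)
qed

lemma tlift_tens:
  assumes "vector_space r" "bilinear_map s t r f"
  shows "tlift r f (tens s t x y) = f x y"
  using assms by (simp add: tens_def tlift_reduce tlift_gen)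

lemma bilinear_tens:
  fixes s :: "'k::field \<Rightarrow> 'a::ab_group_add \<Rightarrow> 'a" and t :: "'k \<Rightarrow> 'b::ab_group_add \<Rightarrow> 'b"
  assumes "vector_space s" "vector_space t"
  shows "bilinear_map s t pm_scale (tens s t)"
proof -
  interpret S: vector_space s by fact
  interpret T: vector_space t by fact
  interpret V: vector_space "pm_scale :: 'k \<Rightarrow> ('k,'a,'b) tensor \<Rightarrow> _" by (rule vector_space_pm_scale)
  interpret Q: Vector_Spaces.linear pm_scale pm_scale "reduce (tens_rel s t)"
    by (rule reduce(1)[OF subspace_tens_rel])
  let ?R = "reduce (tens_rel s t)"
  have R: "?R z = 0" if "z \<in> tens_rel s t" for z
    using that reduce(3)[OF subspace_tens_rel] by blast
  have 1: "?R (gen (x + x', y) - gen (x, y) - gen (x', y)) = 0" for x x' y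
    by (rule R, unfold tens_rel_def, rule V.span_base) blast
  have 2: "?R (gen (x, y + y') - gen (x, y) - gen (x, y')) = 0" for x y y'
    by (rule R, unfold tens_rel_def, rule V.span_base) blast
  have 3: "?R (gen (s c x, y) - pm_scale c (gen (x, y))) = 0" for c x y
    by (rule R, unfold tens_rel_def, rule V.span_base) blast
  have 4: "?R (gen (x, t c y) - pm_scale c (gen (x, y))) = 0" for c x y
    by (rule R, unfold tens_rel_def, rule V.span_base) blast
  show ?thesis unfolding bilinear_map_def Vector_Spaces.linear_iff
    using 1 2 3 4 assms vector_space_pm_scale
    by (auto simp: tens_def Q.add Q.diff Q.scale algebra_simps)
qed

section \<open>Hopf algebras and comodule algebras\<close>

record (overloaded) ('k, 'h) hopf_struct =
  hscale :: "'k::field \<Rightarrow> 'h \<Rightarrow> 'h"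
  comult :: "'h \<Rightarrow> ('k,'h,'h) tensor"
  counit :: "'h \<Rightarrow> 'k"
  antipode :: "'h \<Rightarrow> 'h"

locale hopf_algebra =
  fixes H :: "('k::field, 'h::{ring,monoid_mult}) hopf_struct"
  assumes alg: "algebra_scale (hscale H)"
    and comult_linear: "Vector_Spaces.linear (hscale H) pm_scale (comult H)"
    and comult_closed: "comult H h \<in> tens_space (hscale H) (hscale H) UNIV UNIV"
    and comult_mult: "comult H (g * h) = tmult (hscale H) (hscale H) (comult H g) (comult H h)"
    and comult_one: "comult H 1 = tens (hscale H) (hscale H) 1 1"
    and counit_linear: "Vector_Spaces.linear (hscale H) (*) (counit H)"
    and counit_mult: "counit H (g * h) = counit H g * counit H h"
    and counit_one: "counit H 1 = 1"
    and coassoc: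
      "tlift pm_scale (\<lambda>x z. tlift pm_scale
          (\<lambda>h1 h2. tens (hscale H) pm_scale h1 (tens (hscale H) (hscale H) h2 z)) (comult H x)) (comult H h) =
       tlift pm_scale (\<lambda>x z. tens (hscale H) pm_scale x (comult H z)) (comult H h)"
    and counit_left: "tlift (hscale H) (\<lambda>h1 h2. hscale H (counit H h1) h2) (comult H h) = h"
    and counit_right: "tlift (hscale H) (\<lambda>h1 h2. hscale H (counit H h2) h1) (comult H h) = h"
    and antipode_linear: "Vector_Spaces.linear (hscale H) (hscale H) (antipode H)"
    and antipode_left:
      "tlift (hscale H) (\<lambda>h1 h2. antipode H h1 * h2) (comult H h) = hscale H (counit H h) 1"
    and antipode_right:
      "tlift (hscale H) (\<lambda>h1 h2. h1 * antipode H h2) (comult H h) = hscale H (counit H h) 1"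

definition Hplus :: "('k::field, 'h::{ring,monoid_mult}) hopf_struct \<Rightarrow> 'h set" where
  "Hplus H = {h. counit H h = 0}"

definition pi_eps :: "('k::field, 'h::{ring,monoid_mult}) hopf_struct \<Rightarrow> 'h \<Rightarrow> 'h" where
  "pi_eps H h = h - hscale H (counit H h) 1"

record (overloaded) ('k, 'h, 'a) comod_struct =
  ascale :: "'k::field \<Rightarrow> 'a \<Rightarrow> 'a"
  coact :: "'a \<Rightarrow> ('k,'a,'h) tensor"

locale comodule_algebra =
  fixes H :: "('k::field, 'h::{ring,monoid_mult}) hopf_struct"
    and A :: "('k, 'h, 'a::{ring,monoid_mult}) comod_struct"
  assumes alg: "algebra_scale (ascale A)"
    and coact_linear: "Vector_Spaces.linear (ascale A) pm_scale (coact A)"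
    and coact_closed: "coact A a \<in> tens_space (ascale A) (hscale H) UNIV UNIV"
    and coact_mult: "coact A (a * b) = tmult (ascale A) (hscale H) (coact A a) (coact A b)"
    and coact_one: "coact A 1 = tens (ascale A) (hscale H) 1 1"
    and coact_coassoc:
      "tlift pm_scale (\<lambda>x z. tlift pm_scale
          (\<lambda>a0 a1. tens (ascale A) pm_scale a0 (tens (hscale H) (hscale H) a1 z)) (coact A x)) (coact A a) =
       tlift pm_scale (\<lambda>x z. tens (ascale A) pm_scale x (comult H z)) (coact A a)"
    and coact_counit: "tlift (ascale A) (\<lambda>a0 a1. ascale A (counit H a1) a0) (coact A a) = a"

definition coinvariants ::
  "('k::field, 'h::{ring,monoid_mult}) hopf_struct \<Rightarrow> ('k, 'h, 'a::{ring,monoid_mult}) comod_struct \<Rightarrow> 'a set" where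
  "coinvariants H A = {a. coact A a = tens (ascale A) (hscale H) a 1}"

section \<open>Faithful flatness and quantum principal bundles\<close>

text \<open>
  Left modules over a (noncommutative) subring \<open>B\<close> of a type, on the module records of HOL-Algebra
  (whose fields \<open>mult\<close> and \<open>one\<close> are not used).
\<close>

locale left_module = abelian_group M for B :: "'a::{ring,monoid_mult} set" and M :: "('a, 'm) module" (structure) +
  assumes lsmult_closed: "b \<in> B \<Longrightarrow> m \<in> carrier M \<Longrightarrow> b \<odot> m \<in> carrier M"
    and lsmult_add_left: "b \<in> B \<Longrightarrow> b' \<in> B \<Longrightarrow> m \<in> carrier M \<Longrightarrow> (b + b') \<odot> m = b \<odot> m \<oplus> b' \<odot> m"
    and lsmult_add_right:
      "b \<in> B \<Longrightarrow> m \<in> carrier M \<Longrightarrow> m' \<in> carrier M \<Longrightarrow> b \<odot> (m \<oplus> m') = b \<odot> m \<oplus> b \<odot> m'"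
    and lsmult_mult: "b \<in> B \<Longrightarrow> b' \<in> B \<Longrightarrow> m \<in> carrier M \<Longrightarrow> (b * b') \<odot> m = b \<odot> (b' \<odot> m)"
    and lsmult_one: "m \<in> carrier M \<Longrightarrow> 1 \<odot> m = m"

definition left_module_hom ::
  "'a set \<Rightarrow> ('a, 'm) module \<Rightarrow> ('a, 'n) module \<Rightarrow> ('m \<Rightarrow> 'n) \<Rightarrow> bool" where
  "left_module_hom B M N f \<longleftrightarrow> f \<in> carrier M \<rightarrow> carrier N \<and>
     (\<forall>m\<in>carrier M. \<forall>m'\<in>carrier M. f (m \<oplus>\<^bsub>M\<^esub> m') = f m \<oplus>\<^bsub>N\<^esub> f m') \<and>
     (\<forall>b\<in>B. \<forall>m\<in>carrier M. f (b \<odot>\<^bsub>M\<^esub> m) = b \<odot>\<^bsub>N\<^esub> f m)"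

text \<open>
  The tensor product over \<open>B\<close> of the algebra on the type \<open>'a\<close>, as a right \<open>B\<close>-module by
  multiplication, and a left \<open>B\<close>-module \<open>M\<close>; \<open>B\<close> is a \<open>'k\<close>-subalgebra, so it may be formed from
  formal sums with coefficients in \<open>'k\<close>.
\<close>

definition btens_rel ::
  "('k::field \<Rightarrow> 'a::{ring,monoid_mult} \<Rightarrow> 'a) \<Rightarrow> 'a set \<Rightarrow> ('a, 'm) module \<Rightarrow> ('k,'a,'m) tensor set" where
  "btens_rel s B M = module.span pm_scale
     ({gen (a + a', m) - gen (a, m) - gen (a', m) | a a' m. m \<in> carrier M} \<union>
      {gen (a, m \<oplus>\<^bsub>M\<^esub> m') - gen (a, m) - gen (a, m') | a m m'. m \<in> carrier M \<and> m' \<in> carrier M} \<union>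
      {gen (s c a, m) - pm_scale c (gen (a, m)) | c a m. m \<in> carrier M} \<union>
      {gen (a * b, m) - gen (a, b \<odot>\<^bsub>M\<^esub> m) | a b m. b \<in> B \<and> m \<in> carrier M})"

definition btens ::
  "('k::field \<Rightarrow> 'a::{ring,monoid_mult} \<Rightarrow> 'a) \<Rightarrow> 'a set \<Rightarrow> ('a, 'm) module \<Rightarrow> 'a \<Rightarrow> 'm \<Rightarrow> ('k,'a,'m) tensor" where
  "btens s B M a m = reduce (btens_rel s B M) (gen (a, m))"

definition btens_space ::
  "('k::field \<Rightarrow> 'a::{ring,monoid_mult} \<Rightarrow> 'a) \<Rightarrow> 'a set \<Rightarrow> ('a, 'm) module \<Rightarrow> ('k,'a,'m) tensor set" where
  "btens_space s B M = module.span pm_scale {btens s B M a m | a m. m \<in> carrier M}"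

definition btens_map ::
  "('k::field \<Rightarrow> 'a::{ring,monoid_mult} \<Rightarrow> 'a) \<Rightarrow> 'a set \<Rightarrow> ('a, 'n) module \<Rightarrow> ('m \<Rightarrow> 'n) \<Rightarrow>
   ('k,'a,'m) tensor \<Rightarrow> ('k,'a,'n) tensor" where
  "btens_map s B N f = tlift pm_scale (\<lambda>a m. btens s B N a (f m))"

text \<open>
  A sequence of left \<open>B\<close>-modules is exact if and only if its tensor product with the algebra is
  exact.  A quantifier over all modules has to fix a type for their elements.  Every finitely
  generated \<open>B\<close>-module is isomorphic to one whose elements are lists over \<open>'a\<close> (representatives in
  a power of \<open>B\<close>), and flatness (injectivity on finitely generated left ideals) and faithfulness
  (nonvanishing on nonzero cyclic modules) are detected on finitely generated modules, so nothing is lost.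
\<close>

definition faithfully_flat ::
  "('k::field \<Rightarrow> 'a::{ring,monoid_mult} \<Rightarrow> 'a) \<Rightarrow> 'a set \<Rightarrow> bool" where
  "faithfully_flat s B \<longleftrightarrow>
     (\<forall>(L :: ('a, 'a list) module) (M :: ('a, 'a list) module) (N :: ('a, 'a list) module) f g.
        left_module B L \<and> left_module B M \<and> left_module B N \<and>
        left_module_hom B L M f \<and> left_module_hom B M N g \<longrightarrow>
        (f ` carrier L = {m \<in> carrier M. g m = \<zero>\<^bsub>N\<^esub>} \<longleftrightarrow>
         btens_map s B M f ` btens_space s B L = {T \<in> btens_space s B M. btens_map s B N g T = 0}))"

definition regular_module :: "('a::{ring,monoid_mult}, 'a) module" where
  "regular_module = \<lparr>carrier = UNIV, mult = (*), one = 1, zero = 0, add = (+), smult = (*)\<rparr>"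

definition canonical_map ::
  "('k::field, 'h::{ring,monoid_mult}) hopf_struct \<Rightarrow> ('k, 'h, 'a::{ring,monoid_mult}) comod_struct \<Rightarrow>
   ('k,'a,'a) tensor \<Rightarrow> ('k,'a,'h) tensor" where
  "canonical_map H A = tlift pm_scale (\<lambda>a a'.
     tlift pm_scale (\<lambda>x y. tens (ascale A) (hscale H) (a * x) y) (coact A a'))"

definition hopf_galois ::
  "('k::field, 'h::{ring,monoid_mult}) hopf_struct \<Rightarrow> ('k, 'h, 'a::{ring,monoid_mult}) comod_struct \<Rightarrow> bool" where
  "hopf_galois H A \<longleftrightarrow> bij_betw (canonical_map H A)
     (btens_space (ascale A) (coinvariants H A) regular_module)
     (tens_space (ascale A) (hscale H) UNIV UNIV)"

definition quantum_principal_bundle ::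
  "('k::field, 'h::{ring,monoid_mult}) hopf_struct \<Rightarrow> ('k, 'h, 'a::{ring,monoid_mult}) comod_struct \<Rightarrow> bool" where
  "quantum_principal_bundle H A \<longleftrightarrow> comodule_algebra H A \<and> hopf_galois H A \<and>
     faithfully_flat (ascale A) (coinvariants H A)"

section \<open>Differential calculi\<close>

text \<open>
  A graded algebra on the type \<open>'w\<close> with homogeneous subspaces \<open>grade C n\<close>; the identification of
  the algebra \<open>'a\<close> with the degree zero part is the embedding \<open>incl C\<close>.
\<close>

record (overloaded) ('k, 'a, 'w) calc_struct =
  wscale :: "'k::field \<Rightarrow> 'w \<Rightarrow> 'w"
  grade :: "nat \<Rightarrow> 'w set"
  dif :: "'w \<Rightarrow> 'w"
  incl :: "'a \<Rightarrow> 'w"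

definition homogeneous_decomp :: "(nat \<Rightarrow> 'w::ab_group_add set) \<Rightarrow> 'w \<Rightarrow> (nat \<Rightarrow> 'w) \<Rightarrow> bool" where
  "homogeneous_decomp G w f \<longleftrightarrow>
     finite {n. f n \<noteq> 0} \<and> (\<forall>n. f n \<in> G n) \<and> w = (\<Sum>n\<in>{n. f n \<noteq> 0}. f n)"

definition hcomp :: "(nat \<Rightarrow> 'w::ab_group_add set) \<Rightarrow> nat \<Rightarrow> 'w \<Rightarrow> 'w" where
  "hcomp G n w = (THE f. homogeneous_decomp G w f) n"

locale differential_calculus =
  fixes s :: "'k::field \<Rightarrow> 'a::{ring,monoid_mult} \<Rightarrow> 'a"
    and C :: "('k, 'a, 'w::{ring,monoid_mult}) calc_struct"
  assumes alg: "algebra_scale (wscale C)"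
    and grade_subspace: "module.subspace (wscale C) (grade C n)"
    and grade_direct: "\<exists>!f. homogeneous_decomp (grade C) w f"
    and grade_mult: "x \<in> grade C m \<Longrightarrow> y \<in> grade C n \<Longrightarrow> x * y \<in> grade C (m + n)"
    and incl_linear: "Vector_Spaces.linear s (wscale C) (incl C)"
    and incl_mult: "incl C (a * b) = incl C a * incl C b"
    and incl_one: "incl C 1 = 1"
    and incl_inj: "inj (incl C)"
    and incl_range: "range (incl C) = grade C 0"
    and dif_linear: "Vector_Spaces.linear (wscale C) (wscale C) (dif C)"
    and dif_grade: "x \<in> grade C n \<Longrightarrow> dif C x \<in> grade C (Suc n)"
    and dif_dif: "dif C (dif C x) = 0"
    and leibniz: "x \<in> grade C n \<Longrightarrow> dif C (x * y) = dif C x * y + (-1) ^ n * (x * dif C y)"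
    and grade_span: "grade C n = module.span (wscale C)
      {incl C a * prod_list (map (\<lambda>b. dif C (incl C b)) bs) | a bs. length bs = n}"

subsection \<open>Maximal prolongation\<close>

text \<open>
  The tensor algebra of the bimodule of 1-forms: the word \<open>(a, [m\<^sub>1, ..., m\<^sub>n])\<close> denotes \<open>a\<close> if
  \<open>n = 0\<close>, and the tensor over the algebra of \<open>a m\<^sub>1, m\<^sub>2, ..., m\<^sub>n\<close> otherwise.
  \<open>tensor_alg_rel\<close> is the subspace of formal sums of words which are zero in the tensor algebra.
\<close>

definition form_words :: "('k::field, 'a, 'w::{ring,monoid_mult}) calc_struct \<Rightarrow> ('a \<times> 'w list) set" where
  "form_words C = {(a, ms). set ms \<subseteq> grade C 1}"

definition word_mult ::
  "('k::field, 'a::{ring,monoid_mult}, 'w::{ring,monoid_mult}) calc_struct \<Rightarrow>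
   'a \<times> 'w list \<Rightarrow> 'a \<times> 'w list \<Rightarrow> 'a \<times> 'w list" where
  "word_mult C u v = (if snd u = [] then (fst u * fst v, snd v)
     else (fst u, butlast (snd u) @ [last (snd u) * incl C (fst v)] @ snd v))"

definition words_mult ::
  "('k::field, 'a::{ring,monoid_mult}, 'w::{ring,monoid_mult}) calc_struct \<Rightarrow>
   ('k, 'a, 'w list) tensor \<Rightarrow> ('k, 'a, 'w list) tensor \<Rightarrow> ('k, 'a, 'w list) tensor" where
  "words_mult C X Y = tlift pm_scale (\<lambda>a ms. tlift pm_scale (\<lambda>b ns.
     gen (word_mult C (a, ms) (b, ns))) Y) X"

definition tensor_alg_rel ::
  "('k::field \<Rightarrow> 'a::{ring,monoid_mult} \<Rightarrow> 'a) \<Rightarrow> ('k, 'a, 'w::{ring,monoid_mult}) calc_struct \<Rightarrow>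
   ('k, 'a, 'w list) tensor set" where
  "tensor_alg_rel s C = module.span pm_scale
     ({gen (a + a', ms) - gen (a, ms) - gen (a', ms) | a a' ms. (a, ms) \<in> form_words C} \<union>
      {gen (s c a, ms) - pm_scale c (gen (a, ms)) | c a ms. (a, ms) \<in> form_words C} \<union>
      {gen (a, us @ [m + m'] @ vs) - gen (a, us @ [m] @ vs) - gen (a, us @ [m'] @ vs) | a us m m' vs.
         (a, us @ [m, m'] @ vs) \<in> form_words C} \<union>
      {gen (a, us @ [wscale C c m] @ vs) - pm_scale c (gen (a, us @ [m] @ vs)) | a us c m vs.
         (a, us @ [m] @ vs) \<in> form_words C} \<union>
      {gen (a * b, m # ms) - gen (a, (incl C b * m) # ms) | a b m ms.
         (a, m # ms) \<in> form_words C} \<union>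
      {gen (a, us @ [m * incl C b, m'] @ vs) - gen (a, us @ [m, incl C b * m'] @ vs) | a us m b m' vs.
         (a, us @ [m, m'] @ vs) \<in> form_words C})"

definition prolong_gens ::
  "('k::field, 'a::{ring,monoid_mult}, 'w::{ring,monoid_mult}) calc_struct \<Rightarrow> ('k, 'a, 'w list) tensor set" where
  "prolong_gens C = {\<Sum>i<n. gen (1, [dif C (incl C (a i)), dif C (incl C (b i))]) | (n::nat) a b.
     (\<Sum>i<n. incl C (a i) * dif C (incl C (b i))) = 0}"

text \<open>
  The preimage, in the space of formal sums of words, of the two-sided ideal of the tensor algebra
  generated by \<open>prolong_gens\<close>.
\<close>

definition prolong_ideal ::
  "('k::field \<Rightarrow> 'a::{ring,monoid_mult} \<Rightarrow> 'a) \<Rightarrow> ('k, 'a, 'w::{ring,monoid_mult}) calc_struct \<Rightarrow>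
   ('k, 'a, 'w list) tensor set" where
  "prolong_ideal s C = module.span pm_scale (tensor_alg_rel s C \<union>
     {words_mult C (words_mult C (gen u) r) (gen v) | u r v.
        u \<in> form_words C \<and> r \<in> prolong_gens C \<and> v \<in> form_words C})"

text \<open>
  The calculus \<open>C\<close> is the maximal prolongation of its first order part \<open>grade C 1\<close>: the canonical
  algebra morphism from the tensor algebra (which is onto for every calculus) has the ideal as its
  kernel, that is, it exhibits \<open>C\<close> as the quotient.
\<close>

definition maximal_prolongation ::
  "('k::field \<Rightarrow> 'a::{ring,monoid_mult} \<Rightarrow> 'a) \<Rightarrow> ('k, 'a, 'w::{ring,monoid_mult}) calc_struct \<Rightarrow> bool" where
  "maximal_prolongation s C \<longleftrightarrow>
     {X. Poly_Mapping.keys X \<subseteq> form_words C \<and>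
         tlift (wscale C) (\<lambda>a ms. incl C a * prod_list ms) X = 0} = prolong_ideal s C"

subsection \<open>Bicovariance and the Cartan--Maurer form\<close>

text \<open>
  Left and right coactions on the first order calculus \<open>grade \<Omega>H 1\<close>.  They are determined by their
  compatibility with the bimodule structure and \<open>d\<close>.  Only their values on \<open>grade \<Omega>H 1\<close> matter;
  linearity on the whole type just fixes some linear extension.
\<close>

locale bicovariant_calculus =
  fixes H :: "('k::field, 'h::{ring,monoid_mult}) hopf_struct"
    and \<Omega>H :: "('k, 'h, 'v::{ring,monoid_mult}) calc_struct"
    and lco :: "'v \<Rightarrow> ('k,'h,'v) tensor"
    and rco :: "'v \<Rightarrow> ('k,'v,'h) tensor"
  assumes lco_linear: "Vector_Spaces.linear (wscale \<Omega>H) pm_scale lco"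
    and lco_closed: "\<omega> \<in> grade \<Omega>H 1 \<Longrightarrow> lco \<omega> \<in> tens_space (hscale H) (wscale \<Omega>H) UNIV (grade \<Omega>H 1)"
    and lco_coassoc: "\<omega> \<in> grade \<Omega>H 1 \<Longrightarrow>
      tlift pm_scale (\<lambda>x \<eta>. tlift pm_scale
          (\<lambda>h1 h2. tens (hscale H) pm_scale h1 (tens (hscale H) (wscale \<Omega>H) h2 \<eta>)) (comult H x)) (lco \<omega>) =
      tlift pm_scale (\<lambda>x \<eta>. tens (hscale H) pm_scale x (lco \<eta>)) (lco \<omega>)"
    and lco_counit: "\<omega> \<in> grade \<Omega>H 1 \<Longrightarrow>
      tlift (wscale \<Omega>H) (\<lambda>x \<eta>. wscale \<Omega>H (counit H x) \<eta>) (lco \<omega>) = \<omega>"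
    and lco_left: "\<omega> \<in> grade \<Omega>H 1 \<Longrightarrow> lco (incl \<Omega>H h * \<omega>) =
      tmult (hscale H) (wscale \<Omega>H) (tmap (hscale H) (wscale \<Omega>H) id (incl \<Omega>H) (comult H h)) (lco \<omega>)"
    and lco_right: "\<omega> \<in> grade \<Omega>H 1 \<Longrightarrow> lco (\<omega> * incl \<Omega>H h) =
      tmult (hscale H) (wscale \<Omega>H) (lco \<omega>) (tmap (hscale H) (wscale \<Omega>H) id (incl \<Omega>H) (comult H h))"
    and lco_dif: "lco (dif \<Omega>H (incl \<Omega>H h)) =
      tmap (hscale H) (wscale \<Omega>H) id (\<lambda>x. dif \<Omega>H (incl \<Omega>H x)) (comult H h)"
    and rco_linear: "Vector_Spaces.linear (wscale \<Omega>H) pm_scale rco"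
    and rco_closed: "\<omega> \<in> grade \<Omega>H 1 \<Longrightarrow> rco \<omega> \<in> tens_space (wscale \<Omega>H) (hscale H) (grade \<Omega>H 1) UNIV"
    and rco_coassoc: "\<omega> \<in> grade \<Omega>H 1 \<Longrightarrow>
      tlift pm_scale (\<lambda>\<eta> x. tlift pm_scale
          (\<lambda>\<eta>0 \<eta>1. tens (wscale \<Omega>H) pm_scale \<eta>0 (tens (hscale H) (hscale H) \<eta>1 x)) (rco \<eta>)) (rco \<omega>) =
      tlift pm_scale (\<lambda>\<eta> x. tens (wscale \<Omega>H) pm_scale \<eta> (comult H x)) (rco \<omega>)"
    and rco_counit: "\<omega> \<in> grade \<Omega>H 1 \<Longrightarrow>
      tlift (wscale \<Omega>H) (\<lambda>\<eta> x. wscale \<Omega>H (counit H x) \<eta>) (rco \<omega>) = \<omega>"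
    and rco_left: "\<omega> \<in> grade \<Omega>H 1 \<Longrightarrow> rco (incl \<Omega>H h * \<omega>) =
      tmult (wscale \<Omega>H) (hscale H) (tmap (wscale \<Omega>H) (hscale H) (incl \<Omega>H) id (comult H h)) (rco \<omega>)"
    and rco_right: "\<omega> \<in> grade \<Omega>H 1 \<Longrightarrow> rco (\<omega> * incl \<Omega>H h) =
      tmult (wscale \<Omega>H) (hscale H) (rco \<omega>) (tmap (wscale \<Omega>H) (hscale H) (incl \<Omega>H) id (comult H h))"
    and rco_dif: "rco (dif \<Omega>H (incl \<Omega>H h)) =
      tmap (wscale \<Omega>H) (hscale H) (\<lambda>x. dif \<Omega>H (incl \<Omega>H x)) id (comult H h)"
    and bicomodule: "\<omega> \<in> grade \<Omega>H 1 \<Longrightarrow>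
      tlift pm_scale (\<lambda>\<eta> x. tlift pm_scale
          (\<lambda>y \<zeta>. tens (hscale H) pm_scale y (tens (wscale \<Omega>H) (hscale H) \<zeta> x)) (lco \<eta>)) (rco \<omega>) =
      tlift pm_scale (\<lambda>y \<eta>. tens (hscale H) pm_scale y (rco \<eta>)) (lco \<omega>)"

definition Lambda1 ::
  "('k::field, 'h::{ring,monoid_mult}) hopf_struct \<Rightarrow> ('k, 'h, 'v::{ring,monoid_mult}) calc_struct \<Rightarrow>
   ('v \<Rightarrow> ('k,'h,'v) tensor) \<Rightarrow> 'v set" where
  "Lambda1 H \<Omega>H lco = {\<theta> \<in> grade \<Omega>H 1. lco \<theta> = tens (hscale H) (wscale \<Omega>H) 1 \<theta>}"

definition cartan_maurer ::
  "('k::field, 'h::{ring,monoid_mult}) hopf_struct \<Rightarrow> ('k, 'h, 'v::{ring,monoid_mult}) calc_struct \<Rightarrow> 'h \<Rightarrow> 'v" where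
  "cartan_maurer H \<Omega>H h =
     tlift (wscale \<Omega>H) (\<lambda>h1 h2. incl \<Omega>H (antipode H h1) * dif \<Omega>H (incl \<Omega>H h2)) (comult H h)"

subsection \<open>Complete calculi\<close>

text \<open>
  Product and differential on the graded tensor product of two calculi:
  \<open>(x \<otimes> y)(x' \<otimes> y') = (-1)\<^bsup>|y||x'|\<^esup> xx' \<otimes> yy'\<close> and
  \<open>d(x \<otimes> y) = dx \<otimes> y + (-1)\<^bsup>|x|\<^esup> x \<otimes> dy\<close> for homogeneous elements.
\<close>

definition gtens_mult ::
  "('k::field, 'a, 'w::{ring,monoid_mult}) calc_struct \<Rightarrow> ('k, 'h, 'v::{ring,monoid_mult}) calc_struct \<Rightarrow>
   ('k,'w,'v) tensor \<Rightarrow> ('k,'w,'v) tensor \<Rightarrow> ('k,'w,'v) tensor" where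
  "gtens_mult C D T T' = tlift pm_scale (\<lambda>x y. tlift pm_scale (\<lambda>x' y'.
     \<Sum>m\<in>{m. hcomp (grade D) m y \<noteq> 0}. \<Sum>n\<in>{n. hcomp (grade C) n x' \<noteq> 0}.
       pm_scale ((-1) ^ (m * n))
         (tens (wscale C) (wscale D) (x * hcomp (grade C) n x') (hcomp (grade D) m y * y'))) T') T"

definition gtens_dif ::
  "('k::field, 'a, 'w::{ring,monoid_mult}) calc_struct \<Rightarrow> ('k, 'h, 'v::{ring,monoid_mult}) calc_struct \<Rightarrow>
   ('k,'w,'v) tensor \<Rightarrow> ('k,'w,'v) tensor" where
  "gtens_dif C D = tlift pm_scale (\<lambda>x y. tens (wscale C) (wscale D) (dif C x) y +
     (\<Sum>n\<in>{n. hcomp (grade C) n x \<noteq> 0}.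
       pm_scale ((-1) ^ n) (tens (wscale C) (wscale D) (hcomp (grade C) n x) (dif D y))))"

definition gtens_grade ::
  "('k::field, 'a, 'w::{ring,monoid_mult}) calc_struct \<Rightarrow> ('k, 'h, 'v::{ring,monoid_mult}) calc_struct \<Rightarrow>
   nat \<Rightarrow> ('k,'w,'v) tensor set" where
  "gtens_grade C D n = module.span pm_scale
     {tens (wscale C) (wscale D) x y | x y i j. x \<in> grade C i \<and> y \<in> grade D j \<and> i + j = n}"

text \<open>
  \<open>\<Delta>\<close> is a morphism of differential graded algebras extending the coaction of \<open>A\<close>, so that the
  calculus \<open>\<Omega>A\<close> is complete.  Such a \<open>\<Delta>\<close> is unique, because \<open>\<Omega>A\<close> is generated by \<open>A\<close> and \<open>d\<close>.
\<close>

locale complete_calculus =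
  fixes \<Omega>H :: "('k::field, 'h::{ring,monoid_mult}, 'v::{ring,monoid_mult}) calc_struct"
    and A :: "('k, 'h, 'a::{ring,monoid_mult}) comod_struct"
    and \<Omega>A :: "('k, 'a, 'w::{ring,monoid_mult}) calc_struct"
    and \<Delta> :: "'w \<Rightarrow> ('k,'w,'v) tensor"
  assumes calculus: "differential_calculus (ascale A) \<Omega>A"
    and ext_linear: "Vector_Spaces.linear (wscale \<Omega>A) pm_scale \<Delta>"
    and ext_grade: "\<omega> \<in> grade \<Omega>A n \<Longrightarrow> \<Delta> \<omega> \<in> gtens_grade \<Omega>A \<Omega>H n"
    and ext_mult: "\<Delta> (\<omega> * \<eta>) = gtens_mult \<Omega>A \<Omega>H (\<Delta> \<omega>) (\<Delta> \<eta>)"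
    and ext_one: "\<Delta> 1 = tens (wscale \<Omega>A) (wscale \<Omega>H) 1 1"
    and ext_dif: "\<Delta> (dif \<Omega>A \<omega>) = gtens_dif \<Omega>A \<Omega>H (\<Delta> \<omega>)"
    and ext_coact: "\<Delta> (incl \<Omega>A a) =
      tmap (wscale \<Omega>A) (wscale \<Omega>H) (incl \<Omega>A) (incl \<Omega>H) (coact A a)"

text \<open>
  The coaction on 1-forms, with values in the subspace \<open>\<Omega>\<^sup>1(A) \<otimes> \<Omega>\<^sup>0(H) = \<Omega>\<^sup>1(A) \<otimes> H\<close>.
\<close>

definition coact1 ::
  "('k::field, 'h, 'v::{ring,monoid_mult}) calc_struct \<Rightarrow> ('k, 'a, 'w::{ring,monoid_mult}) calc_struct \<Rightarrow>
   ('w \<Rightarrow> ('k,'w,'v) tensor) \<Rightarrow> 'w \<Rightarrow> ('k,'w,'v) tensor" where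
  "coact1 \<Omega>H \<Omega>A \<Delta> \<omega> =
     tmap (wscale \<Omega>A) (wscale \<Omega>H) (hcomp (grade \<Omega>A) 1) (hcomp (grade \<Omega>H) 0) (\<Delta> \<omega>)"

text \<open>
  The vertical projection \<open>\<pi>\<^sub>v(a da') = a a'\<^sub>0 \<otimes> S(a'\<^sub>1) d(a'\<^sub>2)\<close>, extended to sums; its value does
  not depend on the chosen presentation of the 1-form.
\<close>

definition vert_elem ::
  "('k::field, 'h::{ring,monoid_mult}) hopf_struct \<Rightarrow> ('k, 'h, 'v::{ring,monoid_mult}) calc_struct \<Rightarrow>
   ('k, 'h, 'a::{ring,monoid_mult}) comod_struct \<Rightarrow> 'a \<Rightarrow> 'a \<Rightarrow> ('k,'a,'v) tensor" where
  "vert_elem H \<Omega>H A a a' = tlift pm_scale (\<lambda>x y. tlift pm_scale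
     (\<lambda>y1 y2. tens (ascale A) (wscale \<Omega>H) (a * x) (incl \<Omega>H (antipode H y1) * dif \<Omega>H (incl \<Omega>H y2)))
     (comult H y)) (coact A a')"

definition pi_v ::
  "('k::field, 'h::{ring,monoid_mult}) hopf_struct \<Rightarrow> ('k, 'h, 'v::{ring,monoid_mult}) calc_struct \<Rightarrow>
   ('k, 'h, 'a::{ring,monoid_mult}) comod_struct \<Rightarrow> ('k, 'a, 'w::{ring,monoid_mult}) calc_struct \<Rightarrow>
   'w \<Rightarrow> ('k,'a,'v) tensor" where
  "pi_v H \<Omega>H A \<Omega>A \<omega> = (THE T. \<exists>(n::nat) a a'.
     \<omega> = (\<Sum>i<n. incl \<Omega>A (a i) * dif \<Omega>A (incl \<Omega>A (a' i))) \<and>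
     T = (\<Sum>i<n. vert_elem H \<Omega>H A (a i) (a' i)))"

definition basic_forms ::
  "('k::field, 'h, 'v::{ring,monoid_mult}) calc_struct \<Rightarrow> ('k, 'a, 'w::{ring,monoid_mult}) calc_struct \<Rightarrow>
   ('w \<Rightarrow> ('k,'w,'v) tensor) \<Rightarrow> 'w set" where
  "basic_forms \<Omega>H \<Omega>A \<Delta> = {\<omega>. \<Delta> \<omega> = tens (wscale \<Omega>A) (wscale \<Omega>H) \<omega> 1}"

section \<open>Connections and graded vertical automorphisms\<close>

text \<open>Connection 1-forms are functions on \<open>\<Lambda>\<^sup>1\<close>, i.e. \<open>undefined\<close> outside of it.\<close>

definition connections ::
  "('k::field, 'h::{ring,monoid_mult}) hopf_struct \<Rightarrow> ('k, 'h, 'v::{ring,monoid_mult}) calc_struct \<Rightarrow>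
   ('v \<Rightarrow> ('k,'h,'v) tensor) \<Rightarrow> ('k, 'h, 'a::{ring,monoid_mult}) comod_struct \<Rightarrow>
   ('k, 'a, 'w::{ring,monoid_mult}) calc_struct \<Rightarrow> ('w \<Rightarrow> ('k,'w,'v) tensor) \<Rightarrow> ('v \<Rightarrow> 'w) set" where
  "connections H \<Omega>H lco A \<Omega>A \<Delta> = {s \<in> Lambda1 H \<Omega>H lco \<rightarrow>\<^sub>E grade \<Omega>A 1.
     (\<forall>\<theta>\<in>Lambda1 H \<Omega>H lco. \<forall>\<theta>'\<in>Lambda1 H \<Omega>H lco. s (\<theta> + \<theta>') = s \<theta> + s \<theta>') \<and>
     (\<forall>c. \<forall>\<theta>\<in>Lambda1 H \<Omega>H lco. s (wscale \<Omega>H c \<theta>) = wscale \<Omega>A c (s \<theta>)) \<and>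
     (\<forall>h\<in>Hplus H. coact1 \<Omega>H \<Omega>A \<Delta> (s (cartan_maurer H \<Omega>H h)) =
        tlift pm_scale (\<lambda>x h3. tlift pm_scale (\<lambda>h1 h2.
          tens (wscale \<Omega>A) (wscale \<Omega>H)
            (s (cartan_maurer H \<Omega>H (pi_eps H h2))) (incl \<Omega>H (antipode H h1 * h3)))
          (comult H x)) (comult H h)) \<and>
     (\<forall>\<theta>\<in>Lambda1 H \<Omega>H lco. pi_v H \<Omega>H A \<Omega>A (s \<theta>) = tens (ascale A) (wscale \<Omega>H) 1 \<theta>)}"

definition curvature ::
  "('k::field, 'h::{ring,monoid_mult}) hopf_struct \<Rightarrow> ('k, 'h, 'v::{ring,monoid_mult}) calc_struct \<Rightarrow>
   ('k, 'a, 'w::{ring,monoid_mult}) calc_struct \<Rightarrow> ('v \<Rightarrow> 'w) \<Rightarrow> 'h \<Rightarrow> 'w" where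
  "curvature H \<Omega>H \<Omega>A s h = dif \<Omega>A (s (cartan_maurer H \<Omega>H h)) +
     tlift (wscale \<Omega>A) (\<lambda>h1 h2.
       s (cartan_maurer H \<Omega>H (pi_eps H h1)) * s (cartan_maurer H \<Omega>H (pi_eps H h2))) (comult H h)"

definition vertical_auts ::
  "('k::field, 'h, 'v::{ring,monoid_mult}) calc_struct \<Rightarrow> ('k, 'a, 'w::{ring,monoid_mult}) calc_struct \<Rightarrow>
   ('w \<Rightarrow> ('k,'w,'v) tensor) \<Rightarrow> ('w \<Rightarrow> 'w) set" where
  "vertical_auts \<Omega>H \<Omega>A \<Delta> = {F. Vector_Spaces.linear (wscale \<Omega>A) (wscale \<Omega>A) F \<and>
     (\<forall>n. F ` grade \<Omega>A n \<subseteq> grade \<Omega>A n) \<and>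
     (\<forall>\<beta>\<in>basic_forms \<Omega>H \<Omega>A \<Delta>. \<forall>\<omega>. F (\<beta> * \<omega>) = \<beta> * F \<omega>) \<and>
     bij F \<and> F 1 = 1 \<and>
     (\<forall>\<omega>. \<Delta> (F \<omega>) = tmap (wscale \<Omega>A) (wscale \<Omega>H) F id (\<Delta> \<omega>))}"

definition vertical_aut_group ::
  "('k::field, 'h, 'v::{ring,monoid_mult}) calc_struct \<Rightarrow> ('k, 'a, 'w::{ring,monoid_mult}) calc_struct \<Rightarrow>
   ('w \<Rightarrow> ('k,'w,'v) tensor) \<Rightarrow> ('w \<Rightarrow> 'w) monoid" where
  "vertical_aut_group \<Omega>H \<Omega>A \<Delta> =
     \<lparr>carrier = vertical_auts \<Omega>H \<Omega>A \<Delta>, mult = (\<lambda>F G. G \<circ> F), one = id\<rparr>"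

definition dga_endomorphism ::
  "('k::field, 'a, 'w::{ring,monoid_mult}) calc_struct \<Rightarrow> ('w \<Rightarrow> 'w) \<Rightarrow> bool" where
  "dga_endomorphism C F \<longleftrightarrow> Vector_Spaces.linear (wscale C) (wscale C) F \<and>
     (\<forall>n. F ` grade C n \<subseteq> grade C n) \<and> F 1 = 1 \<and>
     (\<forall>x y. F (x * y) = F x * F y) \<and> (\<forall>x. F (dif C x) = dif C (F x))"

definition aut_act ::
  "('k::field, 'h::{ring,monoid_mult}) hopf_struct \<Rightarrow> ('k, 'h, 'v::{ring,monoid_mult}) calc_struct \<Rightarrow>
   ('v \<Rightarrow> ('k,'h,'v) tensor) \<Rightarrow> ('w \<Rightarrow> 'w) \<Rightarrow> ('v \<Rightarrow> 'w) \<Rightarrow> ('v \<Rightarrow> 'w)" where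
  "aut_act H \<Omega>H lco F s = compose (Lambda1 H \<Omega>H lco) F s"

text \<open>
  Right actions, as left actions of the opposite group.  Since the product of \<open>F\<close> and \<open>G\<close> in
  \<open>vertical_aut_group\<close> is \<open>G \<circ> F\<close>, the action \<open>F \<rhd> s = F \<circ> s\<close> is a right action of that group.
\<close>

definition opposite_group :: "('g, 'm) monoid_scheme \<Rightarrow> ('g, 'm) monoid_scheme" where
  "opposite_group G = G\<lparr>mult := (\<lambda>x y. y \<otimes>\<^bsub>G\<^esub> x)\<rparr>"

definition right_group_action :: "('g, 'm) monoid_scheme \<Rightarrow> 'e set \<Rightarrow> ('g \<Rightarrow> 'e \<Rightarrow> 'e) \<Rightarrow> bool" where
  "right_group_action G E act \<longleftrightarrow> group G \<and>
     group_action (opposite_group G) E (\<lambda>g. restrict (act g) E)"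

end

theory Submission
  imports Defs
begin

text \<open>
  A graded vertical automorphism \<open>F\<close> intertwines the coaction of \<open>\<Omega>\<^sup>\<bullet>(H)\<close> with \<open>F \<otimes> id\<close>, preserves
  degrees and fixes \<open>1\<close>.  The two conditions on a connection 1-form \<open>s\<close> can both be read off from
  homogeneous components of \<open>\<Delta>(s \<theta>)\<close>, and this is why \<open>F \<circ> s\<close> inherits them.

  Covariance concerns the component in \<open>\<Omega>\<^sup>1(A) \<otimes> H\<close>.  Since \<open>F\<close> commutes with taking homogeneous
  components, this component of \<open>\<Delta>(F(s \<theta>))\<close> is the image of that of \<open>\<Delta>(s \<theta>)\<close> under \<open>F \<otimes> id\<close>.

  The condition \<open>\<pi>\<^sub>v(s \<theta>) = 1 \<otimes> \<theta>\<close> concerns the component in \<open>A \<otimes> \<Omega>\<^sup>1(H)\<close>, called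
  \<open>mixed_part\<close> below: for \<open>\<omega> = a da'\<close> it is \<open>a\<^sub>0 a'\<^sub>0 \<otimes> a\<^sub>1 da'\<^sub>1\<close>, which is the image of
  \<open>\<pi>\<^sub>v \<omega> = a a'\<^sub>0 \<otimes> S(a'\<^sub>1) da'\<^sub>2\<close> under \<open>unroll\<close>, the map \<open>a \<otimes> \<theta> \<mapsto> a\<^sub>0 \<otimes> a\<^sub>1 \<theta>\<close>
  (\<open>unroll_vert_elem\<close>).  The latter has the left inverse \<open>a \<otimes> \<theta> \<mapsto> a\<^sub>0 \<otimes> S(a\<^sub>1) \<theta>\<close>
  (\<open>unroll_left_inverse\<close>).  So \<open>\<pi>\<^sub>v\<close> is well defined, and \<open>\<pi>\<^sub>v \<omega>\<close> and the mixed part of \<open>\<omega>\<close>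
  determine each other.  The mixed part of \<open>s \<theta>\<close> is \<open>1 \<otimes> \<theta>\<close>, and \<open>F \<otimes> id\<close> fixes it because
  \<open>F 1 = 1\<close>; hence \<open>\<pi>\<^sub>v(F(s \<theta>)) = 1 \<otimes> \<theta>\<close> (\<open>aut_act_in_connections\<close>).

  The curvature formula is an unfolding of definitions, except that \<open>F \<rhd> s\<close> is a function on \<open>\<Lambda>\<^sup>1\<close>
  only, so that one has to know that \<open>\<varpi>(h)\<close> is left coinvariant
  (\<open>cartan_maurer_in_Lambda1\<close>).  For the action, the vertical automorphisms are closed under
  composition and inverses, and \<open>F \<rhd> (G \<rhd> s) = (F \<circ> G) \<rhd> s\<close> by definition.
\<close>

section \<open>Linear maps out of tensor products\<close>

lemma algebra_scale_vector_space: "algebra_scale s \<Longrightarrow> vector_space s"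
  by (simp add: algebra_scale_def)

lemma linear_left_factor:
  assumes "algebra_scale r" "Vector_Spaces.linear s r f"
  shows "Vector_Spaces.linear s r (\<lambda>x. f x * y)"
  using assms unfolding algebra_scale_def Vector_Spaces.linear_iff
  by (metis distrib_right)

lemma linear_right_factor:
  assumes "algebra_scale r" "Vector_Spaces.linear s r f"
  shows "Vector_Spaces.linear s r (\<lambda>x. y * f x)"
  using assms unfolding algebra_scale_def Vector_Spaces.linear_iff
  by (metis distrib_left)

lemma linear_after:
  assumes "Vector_Spaces.linear s r g" "Vector_Spaces.linear t s f"
  shows "Vector_Spaces.linear t r (\<lambda>x. g (f x))"
  using assms unfolding Vector_Spaces.linear_iff by metis

lemma linear_self: "vector_space s \<Longrightarrow> Vector_Spaces.linear s s (\<lambda>x. x)"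
  by (simp add: Vector_Spaces.linear_iff)

lemma linear_plus:
  assumes "Vector_Spaces.linear s r f" "Vector_Spaces.linear s r g"
  shows "Vector_Spaces.linear s r (\<lambda>x. f x + g x)"
proof -
  interpret f: Vector_Spaces.linear s r f by fact
  interpret g: Vector_Spaces.linear s r g by fact
  interpret vector_space_pair s r by unfold_locales
  show ?thesis by (rule linear_compose_add[OF assms])
qed

lemma linear_sum_functions:
  assumes "vector_space s" "vector_space r" "\<And>n. Vector_Spaces.linear s r (f n)"
  shows "Vector_Spaces.linear s r (\<lambda>x. \<Sum>n\<in>N. f n x)"
proof -
  interpret vector_space_pair s r using assms(1,2) by (simp add: vector_space_pair_def)
  show ?thesis by (rule linear_compose_sum) (use assms(3) in blast)
qed

lemma linear_times_scalar:
  assumes "Vector_Spaces.linear s r f"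
  shows "Vector_Spaces.linear s r (\<lambda>x. r c (f x))"
proof -
  interpret f: Vector_Spaces.linear s r f by fact
  interpret vector_space_pair s r by unfold_locales
  show ?thesis by (rule linear_compose_scale_right[OF assms])
qed

lemma linear_scalar_times:
  assumes "Vector_Spaces.linear s (*) c" "vector_space r"
  shows "Vector_Spaces.linear s r (\<lambda>x. r (c x) v)"
proof -
  interpret vector_space r by fact
  interpret c: Vector_Spaces.linear s "(*)" c by fact
  show ?thesis
    unfolding Vector_Spaces.linear_iff
    using c.vs1.vector_space_axioms assms(2) by (simp add: c.add c.scale scale_left_distrib)
qed

lemma linear_tens_left:
  assumes "Vector_Spaces.linear r s f" "vector_space t"
  shows "Vector_Spaces.linear r pm_scale (\<lambda>x. tens s t (f x) y)"
proof -
  interpret f: Vector_Spaces.linear r s f by fact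
  show ?thesis
    using bilinear_tens[OF f.vs2.vector_space_axioms assms(2)]
    by (intro linear_after[OF _ assms(1)]) (simp add: bilinear_map_def)
qed

lemma linear_tens_right:
  assumes "Vector_Spaces.linear r t f" "vector_space s"
  shows "Vector_Spaces.linear r pm_scale (\<lambda>y. tens s t x (f y))"
proof -
  interpret f: Vector_Spaces.linear r t f by fact
  show ?thesis
    using bilinear_tens[OF assms(2) f.vs2.vector_space_axioms]
    by (intro linear_after[OF _ assms(1), where g = "tens s t x"]) (simp add: bilinear_map_def)
qed

lemma tens_zero_left: "vector_space s \<Longrightarrow> vector_space t \<Longrightarrow> tens s t 0 y = 0"
  using linear_tens_left[OF linear_self, of s t y]
  unfolding Vector_Spaces.linear_iff by (metis add_cancel_right_right)

lemma tens_zero_right: "vector_space s \<Longrightarrow> vector_space t \<Longrightarrow> tens s t x 0 = 0"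
  using linear_tens_right[OF linear_self, of t s x]
  unfolding Vector_Spaces.linear_iff by (metis add_cancel_right_right)

lemma pm_scale_one: "pm_scale 1 T = T"
  by (intro poly_mapping_eqI) simp

lemma pm_scale_zero: "pm_scale c 0 = 0"
  by (intro poly_mapping_eqI) simp

text \<open>
  Together with \<open>tlift_tens_eq\<close> and \<open>tlift_swap\<close>, this is the calculus of Sweedler sums: a linear
  map may be applied under the summation sign, for an arbitrary formal sum \<open>T\<close>.  Bilinearity of
  the summand matters only when the sum is evaluated at an elementary tensor.
\<close>

lemma linear_comp_tlift:
  assumes "Vector_Spaces.linear r r' L"
  shows "L (tlift r f T) = tlift r' (\<lambda>x y. L (f x y)) T"
proof -
  interpret Vector_Spaces.linear r r' L by fact
  show ?thesis by (simp add: tlift_def sum scale)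
qed

lemma linear_tlift_integrand:
  assumes "vector_space s" "vector_space r" "\<And>x y. Vector_Spaces.linear s r (\<lambda>p. f p x y)"
  shows "Vector_Spaces.linear s r (\<lambda>p. tlift r (f p) T)"
proof -
  interpret s: vector_space s by fact
  interpret r: vector_space r by fact
  have "f (a + b) x y = f a x y + f b x y" "f (s c a) x y = r c (f a x y)" for a b c x y
    using assms(3) unfolding Vector_Spaces.linear_iff by auto
  then show ?thesis
    unfolding Vector_Spaces.linear_iff tlift_def using assms(1,2)
    by (simp add: r.scale_right_distrib sum.distrib r.scale_sum_right mult.commute)
qed

lemma linear_tlift_argument:
  assumes "vector_space r" "Vector_Spaces.linear s pm_scale g"
  shows "Vector_Spaces.linear s r (\<lambda>p. tlift r f (g p))"
  by (rule linear_after[OF linear_tlift[OF assms(1)] assms(2)])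

lemma tlift_swap:
  assumes "vector_space r"
  shows "tlift r (\<lambda>x y. tlift r (\<lambda>u v. f x y u v) T') T = tlift r (\<lambda>u v. tlift r (\<lambda>x y. f x y u v) T) T'"
proof -
  interpret vector_space r by fact
  show ?thesis unfolding tlift_def scale_sum_right
    by (subst sum.swap) (simp add: mult.commute)
qed

lemma tlift_subspace:
  assumes "vector_space r" "module.subspace r X" "\<And>x y. f x y \<in> X"
  shows "tlift r f T \<in> X"
proof -
  interpret vector_space r by fact
  show ?thesis unfolding tlift_def
    by (intro subspace_sum subspace_scale assms)
qed

lemma tlift_tens_eq:
  assumes "vector_space r" "\<And>x. Vector_Spaces.linear t r (f x)" "\<And>y. Vector_Spaces.linear s r (\<lambda>x. f x y)"
  shows "tlift r f (tens s t x y) = f x y"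
  using assms by (simp add: tlift_tens bilinear_map_def)

lemma tlift_tmult:
  assumes "vector_space r" "\<And>x. Vector_Spaces.linear t r (f x)" "\<And>y. Vector_Spaces.linear s r (\<lambda>x. f x y)"
  shows "tlift r f (tmult s t T T') = tlift r (\<lambda>x y. tlift r (\<lambda>x' y'. f (x * x') (y * y')) T') T"
  unfolding tmult_def linear_comp_tlift[OF linear_tlift[OF assms(1)]]
  by (simp add: tlift_tens_eq[OF assms])

lemma tmap_tens:
  assumes "Vector_Spaces.linear s s' f" "Vector_Spaces.linear t t' g"
  shows "tmap s' t' f g (tens s t x y) = tens s' t' (f x) (g y)"
proof -
  interpret f: Vector_Spaces.linear s s' f by fact
  interpret g: Vector_Spaces.linear t t' g by fact
  show ?thesis unfolding tmap_def
    by (intro tlift_tens_eq vector_space_pm_scale linear_tens_left linear_tens_right assms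
        f.vs2.vector_space_axioms g.vs2.vector_space_axioms)
qed

lemma tmap_tmap:
  assumes "Vector_Spaces.linear s s' f" "Vector_Spaces.linear t t' g"
  shows "tmap s' t' f g (tmap s t f' g' T) = tmap s' t' (\<lambda>x. f (f' x)) (\<lambda>y. g (g' y)) T"
proof -
  have "tmap s' t' f g (tmap s t f' g' T) = tlift pm_scale (\<lambda>x y. tmap s' t' f g (tens s t (f' x) (g' y))) T"
    unfolding tmap_def[of s t f' g'] unfolding tmap_def[of s' t' f g]
    by (rule linear_comp_tlift[OF linear_tlift[OF vector_space_pm_scale]])
  then show ?thesis
    by (simp only: tmap_tens[OF assms]) (simp only: tmap_def)
qed

lemma linear_eq_on_tens_space:
  assumes "T \<in> tens_space s t X Y"
    and "Vector_Spaces.linear pm_scale r K" "Vector_Spaces.linear pm_scale r L"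
    and "\<And>x y. x \<in> X \<Longrightarrow> y \<in> Y \<Longrightarrow> K (tens s t x y) = L (tens s t x y)"
  shows "K T = L T"
proof -
  interpret K: Vector_Spaces.linear pm_scale r K by fact
  interpret L: Vector_Spaces.linear pm_scale r L by fact
  show ?thesis
    using assms(1) unfolding tens_space_def
  proof (induction rule: K.vs1.span_induct_alt)
    case base then show ?case by (simp add: K.zero L.zero)
  next
    case (step c u v)
    then show ?case using assms(4) by (auto simp: K.add L.add K.scale L.scale)
  qed
qed

lemma tmap_id:
  assumes "vector_space s" "vector_space t" "T \<in> tens_space s t UNIV UNIV"
  shows "tmap s t (\<lambda>x. x) (\<lambda>x. x) T = T"
proof (rule linear_eq_on_tens_space[OF assms(3)])
  show "Vector_Spaces.linear pm_scale pm_scale (tmap s t (\<lambda>x. x) (\<lambda>x. x))"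
    unfolding tmap_def by (rule linear_tlift[OF vector_space_pm_scale])
  show "Vector_Spaces.linear pm_scale pm_scale (\<lambda>x::('a,'b,'c) tensor. x)"
    by (rule linear_self[OF vector_space_pm_scale])
qed (simp add: tmap_tens linear_self assms)

section \<open>Homogeneous components\<close>

context differential_calculus
begin

lemma vector_space_forms: "vector_space (wscale C)"
  using alg by (rule algebra_scale_vector_space)

sublocale W: vector_space "wscale C" by (rule vector_space_forms)

lemma homogeneous_decomp_hcomp: "homogeneous_decomp (grade C) w (\<lambda>n. hcomp (grade C) n w)"
  using theI'[OF grade_direct, of w] by (simp add: hcomp_def)

lemma hcomp_eqI: "homogeneous_decomp (grade C) w f \<Longrightarrow> hcomp (grade C) n w = f n"
  using grade_direct homogeneous_decomp_hcomp by (metis (no_types, lifting))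

lemma finite_hcomp: "finite {n. hcomp (grade C) n w \<noteq> 0}"
  and hcomp_in_grade: "hcomp (grade C) n w \<in> grade C n"
  and sum_hcomp: "(\<Sum>n\<in>{n. hcomp (grade C) n w \<noteq> 0}. hcomp (grade C) n w) = w"
  using homogeneous_decomp_hcomp[of w] unfolding homogeneous_decomp_def by simp_all

lemma hcomp_eq_sumI:
  assumes "finite N" "\<And>n. f n \<in> grade C n" "\<And>n. n \<notin> N \<Longrightarrow> f n = 0" "w = sum f N"
  shows "hcomp (grade C) n w = f n"
proof (rule hcomp_eqI)
  have sub: "{n. f n \<noteq> 0} \<subseteq> N" using assms(3) by auto
  then have "sum f {n. f n \<noteq> 0} = sum f N"
    by (intro sum.mono_neutral_left assms(1)) auto
  then show "homogeneous_decomp (grade C) w f"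
    unfolding homogeneous_decomp_def using assms(1,2,4) finite_subset[OF sub] by simp
qed

lemma zero_in_grade: "0 \<in> grade C n"
  by (rule W.subspace_0[OF grade_subspace])

lemma hcomp_homogeneous:
  assumes "w \<in> grade C n"
  shows "hcomp (grade C) m w = (if m = n then w else 0)"
  by (rule hcomp_eq_sumI[where N = "{n}" and f = "\<lambda>m. if m = n then w else 0"])
    (use assms zero_in_grade in auto)

lemma sum_hcomp_superset:
  assumes "finite N" "{n. hcomp (grade C) n w \<noteq> 0} \<subseteq> N"
  shows "w = (\<Sum>n\<in>N. hcomp (grade C) n w)"
  by (subst (1) sum_hcomp[symmetric], rule sum.mono_neutral_left) (use assms in auto)

lemma linear_hcomp: "Vector_Spaces.linear (wscale C) (wscale C) (hcomp (grade C) n)"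
proof -
  have "hcomp (grade C) n (x + y) = hcomp (grade C) n x + hcomp (grade C) n y" for x y
  proof (rule hcomp_eq_sumI)
    let ?N = "{n. hcomp (grade C) n x \<noteq> 0} \<union> {n. hcomp (grade C) n y \<noteq> 0}"
    show "finite ?N" by (simp add: finite_hcomp)
    show "x + y = (\<Sum>n\<in>?N. hcomp (grade C) n x + hcomp (grade C) n y)"
      unfolding sum.distrib using finite_hcomp
      by (intro arg_cong2[where f = plus] sum_hcomp_superset) auto
  qed (auto intro: W.subspace_add[OF grade_subspace] hcomp_in_grade)
  moreover have "hcomp (grade C) n (wscale C c x) = wscale C c (hcomp (grade C) n x)" for c x
  proof (rule hcomp_eq_sumI)
    show "wscale C c x = (\<Sum>n\<in>{n. hcomp (grade C) n x \<noteq> 0}. wscale C c (hcomp (grade C) n x))"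
      by (simp add: sum_hcomp flip: W.scale_sum_right)
  qed (auto intro: W.subspace_scale[OF grade_subspace] hcomp_in_grade finite_hcomp)
  ultimately show ?thesis
    unfolding Vector_Spaces.linear_iff using vector_space_forms by blast
qed

text \<open>
  The product and the differential of a graded tensor product are sums over the nonzero
  homogeneous components of an argument.  The range of summation depends on that argument; linearity
  holds because the range may be enlarged to any finite set containing it.
\<close>

lemma linear_sum_hcomp:
  assumes "\<And>n. Vector_Spaces.linear (wscale C) r (f n)"
  shows "Vector_Spaces.linear (wscale C) r (\<lambda>x. \<Sum>n\<in>{n. hcomp (grade C) n x \<noteq> 0}. f n (hcomp (grade C) n x))"
proof -
  interpret f: Vector_Spaces.linear "wscale C" r "f n" for n by (rule assms)
  interpret h: Vector_Spaces.linear "wscale C" "wscale C" "hcomp (grade C) n" for n by (rule linear_hcomp)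
  let ?S = "\<lambda>x. \<Sum>n\<in>{n. hcomp (grade C) n x \<noteq> 0}. f n (hcomp (grade C) n x)"
  have S: "?S x = (\<Sum>n\<in>N. f n (hcomp (grade C) n x))"
    if "finite N" "{n. hcomp (grade C) n x \<noteq> 0} \<subseteq> N" for N x
    by (rule sum.mono_neutral_left) (use that f.zero in auto)
  have "?S (x + y) = ?S x + ?S y" for x y
  proof -
    let ?N = "{n. hcomp (grade C) n x \<noteq> 0} \<union> {n. hcomp (grade C) n y \<noteq> 0}"
    have "finite ?N" by (simp add: finite_hcomp)
    then show ?thesis
      by (subst (1 2 3) S[where N = ?N]) (auto simp: h.add f.add sum.distrib)
  qed
  moreover have "?S (wscale C c x) = r c (?S x)" for c x
    by (subst S[where N = "{n. hcomp (grade C) n x \<noteq> 0}"])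
      (auto simp: finite_hcomp h.scale f.scale f.vs2.scale_sum_right)
  ultimately show ?thesis
    unfolding Vector_Spaces.linear_iff using vector_space_forms f.vs2.vector_space_axioms by blast
qed

lemma sum_hcomp_homogeneous:
  assumes "x \<in> grade C n" "f n 0 = 0"
  shows "(\<Sum>m\<in>{m. hcomp (grade C) m x \<noteq> 0}. f m (hcomp (grade C) m x)) = f n x"
proof (cases "x = 0")
  case True
  then have "{m. hcomp (grade C) m x \<noteq> 0} = {}" using hcomp_homogeneous[OF zero_in_grade] by simp
  then show ?thesis using True assms(2) by simp
next
  case False
  then have "{m. hcomp (grade C) m x \<noteq> 0} = {n}" by (auto simp: hcomp_homogeneous[OF assms(1)])
  then show ?thesis by (simp add: hcomp_homogeneous[OF assms(1)])
qed

lemma incl_in_grade: "incl C a \<in> grade C 0"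
  using incl_range by auto

lemma dif_incl_in_grade: "dif C (incl C a) \<in> grade C 1"
  using dif_grade[OF incl_in_grade] by simp

lemma one_forms_are_sums:
  assumes "\<omega> \<in> grade C 1"
  shows "\<exists>(n::nat) a a'. \<omega> = (\<Sum>i<n. incl C (a i) * dif C (incl C (a' i)))"
proof -
  have "\<omega> \<in> module.span (wscale C) {incl C a * prod_list (map (\<lambda>b. dif C (incl C b)) bs) | a bs. length bs = 1}"
    using assms grade_span by simp
  then show ?thesis
  proof (induction rule: W.span_induct_alt)
    case base
    show ?case by (rule exI[of _ 0]) simp
  next
    case (step c u v)
    interpret i: Vector_Spaces.linear s "wscale C" "incl C" by (rule incl_linear)
    obtain a b where u: "u = incl C a * dif C (incl C b)"
      using step(1) by (auto simp: length_Suc_conv)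
    obtain n :: nat and a0 a' where v: "v = (\<Sum>i<n. incl C (a0 i) * dif C (incl C (a' i)))"
      using step(2) by blast
    have cu: "wscale C c u = incl C (s c a) * dif C (incl C b)"
      using alg by (simp add: u i.scale algebra_scale_def)
    have "wscale C c u + v = (\<Sum>i<Suc n. incl C ((a0(n := s c a)) i) * dif C (incl C ((a'(n := b)) i)))"
      by (simp add: cu v add.commute)
    then show ?case by blast
  qed
qed

end


section \<open>The Cartan-Maurer form is left coinvariant\<close>

context hopf_algebra
begin

lemma vector_space_hopf: "vector_space (hscale H)"
  using alg by (rule algebra_scale_vector_space)

text \<open>
  Coassociativity \<open>h\<^sub>1\<^sub>1 \<otimes> h\<^sub>1\<^sub>2 \<otimes> h\<^sub>2 = h\<^sub>1 \<otimes> h\<^sub>2\<^sub>1 \<otimes> h\<^sub>2\<^sub>2\<close> in the form in which Sweedler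
  notation uses it, that is, after a trilinear map \<open>f\<close> has been applied to both sides.
\<close>

lemma tlift_coassoc:
  assumes r: "vector_space r"
    and f: "\<And>y z. Vector_Spaces.linear (hscale H) r (\<lambda>x. f x y z)"
      "\<And>x z. Vector_Spaces.linear (hscale H) r (\<lambda>y. f x y z)"
      "\<And>x y. Vector_Spaces.linear (hscale H) r (\<lambda>z. f x y z)"
  shows "tlift r (\<lambda>x z. tlift r (\<lambda>u v. f u v z) (comult H x)) (comult H h) =
    tlift r (\<lambda>x z. tlift r (\<lambda>u v. f x u v) (comult H z)) (comult H h)"
proof -
  let ?L = "tlift r (\<lambda>x T. tlift r (f x) T)"
  have L: "Vector_Spaces.linear pm_scale r ?L" by (rule linear_tlift[OF r])
  have "?L (tens (hscale H) pm_scale x T) = tlift r (f x) T" for x T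
    by (rule tlift_tens_eq)
      (auto intro!: r f linear_tlift linear_tlift_integrand vector_space_hopf)
  moreover have "tlift r (f x) (tens (hscale H) (hscale H) y z) = f x y z" for x y z
    by (rule tlift_tens_eq) (auto intro: r f)
  ultimately show ?thesis
    using arg_cong[OF coassoc[of h], of ?L] by (simp add: linear_comp_tlift[OF L])
qed

lemma tlift_antipode_left:
  assumes "Vector_Spaces.linear (hscale H) r g"
  shows "tlift r (\<lambda>u v. g (antipode H u * v)) (comult H h) = r (counit H h) (g 1)"
  using arg_cong[OF antipode_left[of h], of g] assms
  by (simp add: linear_comp_tlift[OF assms] Vector_Spaces.linear_iff)

lemma tlift_antipode_right:
  assumes "Vector_Spaces.linear (hscale H) r g"
  shows "tlift r (\<lambda>u v. g (u * antipode H v)) (comult H h) = r (counit H h) (g 1)"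
  using arg_cong[OF antipode_right[of h], of g] assms
  by (simp add: linear_comp_tlift[OF assms] Vector_Spaces.linear_iff)

lemma tlift_counit_left:
  assumes "Vector_Spaces.linear (hscale H) r g"
  shows "tlift r (\<lambda>u v. r (counit H u) (g v)) (comult H h) = g h"
  using arg_cong[OF counit_left[of h], of g] assms
  by (simp add: linear_comp_tlift[OF assms] Vector_Spaces.linear_iff)

end

locale hopf_calculus =
  hopf_algebra H + forms: differential_calculus "hscale H" \<Omega>H + bicovariant_calculus H \<Omega>H lco rco
  for H :: "('k::field, 'h::{ring,monoid_mult}) hopf_struct"
    and \<Omega>H :: "('k, 'h, 'v::{ring,monoid_mult}) calc_struct"
    and lco :: "'v \<Rightarrow> ('k,'h,'v) tensor"
    and rco :: "'v \<Rightarrow> ('k,'v,'h) tensor"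
begin

lemmas linear_intros =
  linear_left_factor[OF alg] linear_right_factor[OF alg]
  linear_left_factor[OF forms.alg] linear_right_factor[OF forms.alg]
  linear_tens_left[OF _ vector_space_hopf] linear_tens_right[OF _ vector_space_hopf]
  linear_tens_left[OF _ forms.vector_space_forms] linear_tens_right[OF _ forms.vector_space_forms]
  linear_after[OF forms.incl_linear] linear_after[OF forms.dif_linear]
  linear_after[OF antipode_linear] linear_after[OF comult_linear] linear_after[OF counit_linear]
  linear_scalar_times linear_times_scalar linear_plus
  linear_tlift_argument linear_tlift_integrand
  vector_space_hopf forms.vector_space_forms vector_space_pm_scale
  linear_self[OF vector_space_hopf] linear_self[OF forms.vector_space_forms]
  linear_self[OF vector_space_pm_scale]

lemma linear_cartan_maurer: "Vector_Spaces.linear (hscale H) (wscale \<Omega>H) (cartan_maurer H \<Omega>H)"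
  unfolding cartan_maurer_def by (intro linear_intros)

text \<open>
  The form \<open>\<varpi>\<close> trivialises the bimodule of 1-forms: \<open>h\<^sub>1 \<varpi>(h\<^sub>2) = h\<^sub>1 S(h\<^sub>2) dh\<^sub>3 = dh\<close>.
\<close>

lemma dif_eq_cartan_maurer:
  "dif \<Omega>H (incl \<Omega>H h) = tlift (wscale \<Omega>H) (\<lambda>x z. incl \<Omega>H x * cartan_maurer H \<Omega>H z) (comult H h)"
proof -
  let ?r = "wscale \<Omega>H" and ?i = "incl \<Omega>H" and ?d = "\<lambda>h. dif \<Omega>H (incl \<Omega>H h)" and ?S = "antipode H"
  have push: "?i x * tlift ?r (\<lambda>u v. ?i (?S u) * ?d v) T = tlift ?r (\<lambda>u v. ?i x * (?i (?S u) * ?d v)) T" for x T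
    by (rule linear_comp_tlift) (intro linear_intros)
  have "tlift ?r (\<lambda>x z. ?i x * cartan_maurer H \<Omega>H z) (comult H h) =
      tlift ?r (\<lambda>x z. tlift ?r (\<lambda>u v. ?i x * (?i (?S u) * ?d v)) (comult H z)) (comult H h)"
    by (simp only: cartan_maurer_def push)
  also have "\<dots> = tlift ?r (\<lambda>x z. tlift ?r (\<lambda>u v. ?i u * (?i (?S v) * ?d z)) (comult H x)) (comult H h)"
    by (rule tlift_coassoc[symmetric]) (intro linear_intros)+
  also have "\<dots> = tlift ?r (\<lambda>x z. tlift ?r (\<lambda>u v. ?i (u * ?S v) * ?d z) (comult H x)) (comult H h)"
    by (simp only: forms.incl_mult mult.assoc)
  also have "\<dots> = tlift ?r (\<lambda>x z. ?r (counit H x) (?d z)) (comult H h)"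
    by (subst tlift_antipode_right) (auto intro!: linear_intros simp: forms.incl_one)
  also have "\<dots> = ?d h"
    by (rule tlift_counit_left) (intro linear_intros)
  finally show ?thesis by simp
qed

text \<open>
  The left action \<open>g \<cdot> T = \<Delta>(g) T\<close> of \<open>H\<close> on \<open>H \<otimes> \<Omega>(H)\<close>, for which the left coaction on 1-forms is
  \<open>H\<close>-linear.
\<close>

definition left_act :: "'h \<Rightarrow> ('k,'h,'v) tensor \<Rightarrow> ('k,'h,'v) tensor" where
  "left_act g T = tlift pm_scale (\<lambda>u v. tlift pm_scale
     (\<lambda>x \<eta>. tens (hscale H) (wscale \<Omega>H) (u * x) (incl \<Omega>H v * \<eta>)) T) (comult H g)"

lemma left_act_tens:
  "left_act g (tens (hscale H) (wscale \<Omega>H) x \<eta>) =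
    tlift pm_scale (\<lambda>u v. tens (hscale H) (wscale \<Omega>H) (u * x) (incl \<Omega>H v * \<eta>)) (comult H g)"
  unfolding left_act_def by (subst tlift_tens_eq) (intro linear_intros refl)+

lemma linear_left_act: "Vector_Spaces.linear pm_scale pm_scale (left_act g)"
  unfolding left_act_def by (intro linear_intros)

lemma linear_left_act': "Vector_Spaces.linear (hscale H) pm_scale (\<lambda>g. left_act g T)"
  unfolding left_act_def by (intro linear_intros)

lemma lco_left_act: "\<omega> \<in> grade \<Omega>H 1 \<Longrightarrow> lco (incl \<Omega>H g * \<omega>) = left_act g (lco \<omega>)"
  unfolding left_act_def lco_left tmult_def tmap_def
  unfolding linear_comp_tlift[OF linear_tlift[OF vector_space_pm_scale]]
  by (subst tlift_tens_eq) (auto intro!: linear_intros)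

lemma left_act_mult:
  "left_act g (left_act h (tens (hscale H) (wscale \<Omega>H) x \<eta>)) = left_act (g * h) (tens (hscale H) (wscale \<Omega>H) x \<eta>)"
proof -
  have "left_act g (left_act h (tens (hscale H) (wscale \<Omega>H) x \<eta>)) =
      tlift pm_scale (\<lambda>p q. tlift pm_scale (\<lambda>u v.
        tens (hscale H) (wscale \<Omega>H) (u * (p * x)) (incl \<Omega>H v * (incl \<Omega>H q * \<eta>))) (comult H g)) (comult H h)"
    unfolding left_act_tens[of h] linear_comp_tlift[OF linear_left_act] by (simp only: left_act_tens)
  also have "\<dots> = left_act (g * h) (tens (hscale H) (wscale \<Omega>H) x \<eta>)"
    unfolding left_act_tens comult_mult
    by (subst tlift_tmult, (intro linear_intros)+, subst tlift_swap[OF vector_space_pm_scale])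
      (simp only: mult.assoc forms.incl_mult)
  finally show ?thesis .
qed

lemma left_act_one: "left_act 1 (tens (hscale H) (wscale \<Omega>H) x \<eta>) = tens (hscale H) (wscale \<Omega>H) x \<eta>"
  unfolding left_act_tens comult_one
  by (subst tlift_tens_eq) (auto intro!: linear_intros simp: forms.incl_one)

lemma cartan_maurer_in_grade: "cartan_maurer H \<Omega>H h \<in> grade \<Omega>H 1"
  unfolding cartan_maurer_def
  using forms.grade_mult[OF forms.incl_in_grade forms.dif_incl_in_grade]
  by (intro tlift_subspace forms.vector_space_forms forms.grade_subspace) simp

text \<open>
  Since \<open>dh = h\<^sub>1 \<varpi>(h\<^sub>2)\<close>, the coaction sends \<open>dh\<close> to
  \<open>h\<^sub>1 \<otimes> dh\<^sub>2 = h\<^sub>1 \<otimes> h\<^sub>2 \<varpi>(h\<^sub>3) = h\<^sub>1 \<cdot> (1 \<otimes> \<varpi>(h\<^sub>2))\<close>.  By linearity it sends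
  \<open>\<varpi>(h) = S(h\<^sub>1) dh\<^sub>2\<close> to \<open>(S(h\<^sub>1) h\<^sub>2) \<cdot> (1 \<otimes> \<varpi>(h\<^sub>3)) = 1 \<otimes> \<varpi>(h)\<close>.  The
  contraction \<open>S(h\<^sub>1) h\<^sub>2 = \<epsilon>(h)\<close> takes place before \<open>\<Delta>\<close> is applied, because \<open>\<Delta>\<close> is multiplicative.
\<close>

lemma cartan_maurer_in_Lambda1: "cartan_maurer H \<Omega>H h \<in> Lambda1 H \<Omega>H lco"
proof -
  let ?t = "tens (hscale H) (wscale \<Omega>H)" and ?w = "cartan_maurer H \<Omega>H" and ?S = "antipode H"
  note push = linear_comp_tlift[OF linear_left_act]
  have tens_push: "?t u (tlift (wscale \<Omega>H) f T) = tlift pm_scale (\<lambda>x y. ?t u (f x y)) T" for u f and T :: "('k,'h,'h) tensor"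
    by (rule linear_comp_tlift) (intro linear_intros)
  note lin = linear_intros linear_after[OF linear_left_act] linear_after[OF linear_left_act'] linear_after[OF linear_cartan_maurer]
  have lco_dH: "lco (dif \<Omega>H (incl \<Omega>H h)) = tlift pm_scale (\<lambda>x z. left_act x (?t 1 (?w z))) (comult H h)" for h
  proof -
    have "lco (dif \<Omega>H (incl \<Omega>H h)) =
        tlift pm_scale (\<lambda>x z. tlift pm_scale (\<lambda>u v. ?t x (incl \<Omega>H u * ?w v)) (comult H z)) (comult H h)"
      unfolding lco_dif tmap_def unfolding dif_eq_cartan_maurer tens_push id_apply ..
    also have "\<dots> = tlift pm_scale (\<lambda>x z. tlift pm_scale (\<lambda>u v. ?t u (incl \<Omega>H v * ?w z)) (comult H x)) (comult H h)"
      by (rule tlift_coassoc[symmetric]) (intro lin)+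
    finally show ?thesis by (simp only: left_act_tens mult_1_right)
  qed
  have "lco (?w h) = tlift pm_scale (\<lambda>x y. left_act (?S x) (lco (dif \<Omega>H (incl \<Omega>H y)))) (comult H h)"
    unfolding cartan_maurer_def linear_comp_tlift[OF lco_linear]
    by (simp only: lco_left_act[OF forms.dif_incl_in_grade])
  also have "\<dots> = tlift pm_scale (\<lambda>x y. tlift pm_scale (\<lambda>u v. left_act (?S x * u) (?t 1 (?w v))) (comult H y)) (comult H h)"
    by (simp only: lco_dH push left_act_mult)
  also have "\<dots> = tlift pm_scale (\<lambda>x y. tlift pm_scale (\<lambda>u v. left_act (?S u * v) (?t 1 (?w y))) (comult H x)) (comult H h)"
    by (rule tlift_coassoc[symmetric]) (intro lin)+
  also have "\<dots> = tlift pm_scale (\<lambda>x y. pm_scale (counit H x) (?t 1 (?w y))) (comult H h)"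
    by (subst tlift_antipode_left) (auto intro!: lin simp: left_act_one)
  also have "\<dots> = ?t 1 (?w h)"
    by (rule tlift_counit_left) (intro lin)
  finally show ?thesis
    unfolding Lambda1_def using cartan_maurer_in_grade by simp
qed

end


section \<open>The vertical projection and the coaction\<close>

lemma (in comodule_algebra) vector_space_bundle: "vector_space (ascale A)"
  using alg by (rule algebra_scale_vector_space)

locale complete_bundle =
  hopf_calculus H \<Omega>H lco rco + comod: comodule_algebra H A +
  total: differential_calculus "ascale A" \<Omega>A + complete_calculus \<Omega>H A \<Omega>A \<Delta>
  for H :: "('k::field, 'h::{ring,monoid_mult}) hopf_struct"
    and \<Omega>H :: "('k, 'h, 'v::{ring,monoid_mult}) calc_struct"
    and lco :: "'v \<Rightarrow> ('k,'h,'v) tensor"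
    and rco :: "'v \<Rightarrow> ('k,'v,'h) tensor"
    and A :: "('k, 'h, 'a::{ring,monoid_mult}) comod_struct"
    and \<Omega>A :: "('k, 'a, 'w::{ring,monoid_mult}) calc_struct"
    and \<Delta> :: "'w \<Rightarrow> ('k,'w,'v) tensor"
begin

abbreviation tensW :: "'w \<Rightarrow> 'v \<Rightarrow> ('k,'w,'v) tensor" where
  "tensW \<equiv> tens (wscale \<Omega>A) (wscale \<Omega>H)"

abbreviation tensA :: "'a \<Rightarrow> 'v \<Rightarrow> ('k,'a,'v) tensor" where
  "tensA \<equiv> tens (ascale A) (wscale \<Omega>H)"

lemmas bundle_linear_intros = linear_intros
  linear_left_factor[OF comod.alg] linear_right_factor[OF comod.alg]
  linear_left_factor[OF total.alg] linear_right_factor[OF total.alg]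
  linear_tens_left[OF _ comod.vector_space_bundle] linear_tens_right[OF _ comod.vector_space_bundle]
  linear_tens_left[OF _ total.vector_space_forms] linear_tens_right[OF _ total.vector_space_forms]
  linear_after[OF total.incl_linear] linear_after[OF total.dif_linear]
  linear_after[OF comod.coact_linear]
  linear_after[OF total.linear_hcomp] linear_after[OF forms.linear_hcomp]
  comod.vector_space_bundle total.vector_space_forms
  linear_self[OF comod.vector_space_bundle] linear_self[OF total.vector_space_forms]

lemma tlift_coact_coassoc:
  assumes r: "vector_space r"
    and f: "\<And>y z. Vector_Spaces.linear (ascale A) r (\<lambda>x. f x y z)"
      "\<And>x z. Vector_Spaces.linear (hscale H) r (\<lambda>y. f x y z)"
      "\<And>x y. Vector_Spaces.linear (hscale H) r (\<lambda>z. f x y z)"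
  shows "tlift r (\<lambda>x z. tlift r (\<lambda>u v. f u v z) (coact A x)) (coact A a) =
    tlift r (\<lambda>x z. tlift r (\<lambda>u v. f x u v) (comult H z)) (coact A a)"
proof -
  let ?L = "tlift r (\<lambda>x T. tlift r (f x) T)"
  have L: "Vector_Spaces.linear pm_scale r ?L" by (rule linear_tlift[OF r])
  have "?L (tens (ascale A) pm_scale x T) = tlift r (f x) T" for x T
    by (rule tlift_tens_eq)
      (auto intro!: r f linear_tlift linear_tlift_integrand comod.vector_space_bundle)
  moreover have "tlift r (f x) (tens (hscale H) (hscale H) y z) = f x y z" for x y z
    by (rule tlift_tens_eq) (auto intro: r f)
  ultimately show ?thesis
    using arg_cong[OF comod.coact_coassoc[of a], of ?L] by (simp add: linear_comp_tlift[OF L])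
qed

lemma tlift_coact_counit:
  assumes "Vector_Spaces.linear (ascale A) r g"
  shows "tlift r (\<lambda>u v. r (counit H v) (g u)) (coact A a) = g a"
  using arg_cong[OF comod.coact_counit[of a], of g] assms
  by (simp add: linear_comp_tlift[OF assms] Vector_Spaces.linear_iff)

lemma gtens_dif_incl:
  "gtens_dif \<Omega>A \<Omega>H (tensW (incl \<Omega>A x) (incl \<Omega>H y)) =
    tensW (dif \<Omega>A (incl \<Omega>A x)) (incl \<Omega>H y) + tensW (incl \<Omega>A x) (dif \<Omega>H (incl \<Omega>H y))"
proof -
  have "(\<Sum>n\<in>{n. hcomp (grade \<Omega>A) n (incl \<Omega>A x) \<noteq> 0}.
      pm_scale ((-1) ^ n) (tensW (hcomp (grade \<Omega>A) n (incl \<Omega>A x)) z)) = tensW (incl \<Omega>A x) z" for z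
    by (subst total.sum_hcomp_homogeneous[OF total.incl_in_grade])
      (auto simp: pm_scale_one tens_zero_left total.vector_space_forms forms.vector_space_forms)
  then show ?thesis
    unfolding gtens_dif_def
    by (subst tlift_tens_eq)
      (auto intro!: bundle_linear_intros linear_sum_functions total.linear_sum_hcomp)
qed

lemma gtens_mult_homogeneous:
  assumes "b \<in> grade \<Omega>H m" "c \<in> grade \<Omega>A n"
  shows "gtens_mult \<Omega>A \<Omega>H (tensW a b) (tensW c e) = pm_scale ((-1) ^ (m * n)) (tensW (a * c) (b * e))"
proof -
  let ?f = "\<lambda>x y x' y'. \<Sum>m\<in>{m. hcomp (grade \<Omega>H) m y \<noteq> 0}. \<Sum>n\<in>{n. hcomp (grade \<Omega>A) n x' \<noteq> 0}.
       pm_scale ((-1) ^ (m * n)) (tensW (x * hcomp (grade \<Omega>A) n x') (hcomp (grade \<Omega>H) m y * y'))"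
  note lin = bundle_linear_intros linear_sum_functions
  have x: "Vector_Spaces.linear (wscale \<Omega>A) pm_scale (\<lambda>x. ?f x y x' y')" for y x' y'
    by (intro lin)
  have y: "Vector_Spaces.linear (wscale \<Omega>H) pm_scale (\<lambda>y. ?f x y x' y')" for x x' y'
    by (rule forms.linear_sum_hcomp) (intro lin)
  have x': "Vector_Spaces.linear (wscale \<Omega>A) pm_scale (\<lambda>x'. ?f x y x' y')" for x y y'
    by (rule linear_sum_functions total.linear_sum_hcomp total.vector_space_forms vector_space_pm_scale)+ (intro lin)
  have y': "Vector_Spaces.linear (wscale \<Omega>H) pm_scale (\<lambda>y'. ?f x y x' y')" for x y x'
    by (intro lin)
  have "gtens_mult \<Omega>A \<Omega>H (tensW a b) (tensW c e) = ?f a b c e"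
    unfolding gtens_mult_def
    by (subst tlift_tens_eq, (intro vector_space_pm_scale linear_tlift_integrand forms.vector_space_forms
          total.vector_space_forms x y)+, rule tlift_tens_eq, (intro vector_space_pm_scale x' y')+)
  also have "\<dots> = (\<Sum>n\<in>{n. hcomp (grade \<Omega>A) n c \<noteq> 0}.
       pm_scale ((-1) ^ (m * n)) (tensW (a * hcomp (grade \<Omega>A) n c) (b * e)))"
    by (rule forms.sum_hcomp_homogeneous[OF assms(1)])
      (simp add: tens_zero_right tens_zero_left pm_scale_zero total.vector_space_forms forms.vector_space_forms)
  also have "\<dots> = pm_scale ((-1) ^ (m * n)) (tensW (a * c) (b * e))"
    by (rule total.sum_hcomp_homogeneous[OF assms(2)])
      (simp add: tens_zero_left pm_scale_zero total.vector_space_forms forms.vector_space_forms)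
  finally show ?thesis .
qed

text \<open>
  The component of \<open>\<Delta> \<omega>\<close> in \<open>A \<otimes> \<Omega>\<^sup>1(H)\<close>; for a 1-form it is complementary to \<open>coact1\<close>.
\<close>

definition mixed_part :: "'w \<Rightarrow> ('k,'w,'v) tensor" where
  "mixed_part \<omega> = tmap (wscale \<Omega>A) (wscale \<Omega>H) (hcomp (grade \<Omega>A) 0) (hcomp (grade \<Omega>H) 1) (\<Delta> \<omega>)"

lemma linear_mixed_part: "Vector_Spaces.linear (wscale \<Omega>A) pm_scale mixed_part"
  unfolding mixed_part_def tmap_def
  by (rule linear_after[OF linear_tlift[OF vector_space_pm_scale] ext_linear])

text \<open>
  \<open>\<Delta>(a da')\<close> is the product of \<open>a\<^sub>0 \<otimes> a\<^sub>1\<close> and \<open>d(a'\<^sub>0 \<otimes> a'\<^sub>1) = da'\<^sub>0 \<otimes> a'\<^sub>1 + a'\<^sub>0 \<otimes> da'\<^sub>1\<close>.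
  The second summand contributes the mixed part; no signs appear because \<open>a\<^sub>1\<close> and \<open>a'\<^sub>0\<close> have degree 0.
\<close>

lemma mixed_part_form:
  "mixed_part (incl \<Omega>A a * dif \<Omega>A (incl \<Omega>A a')) = tlift pm_scale (\<lambda>p q. tlift pm_scale (\<lambda>x y.
     tensW (incl \<Omega>A (p * x)) (incl \<Omega>H q * dif \<Omega>H (incl \<Omega>H y))) (coact A a')) (coact A a)"
proof -
  let ?m = "gtens_mult \<Omega>A \<Omega>H" and ?P = "tmap (wscale \<Omega>A) (wscale \<Omega>H) (hcomp (grade \<Omega>A) 0) (hcomp (grade \<Omega>H) 1)"
  have P: "Vector_Spaces.linear pm_scale pm_scale ?P"
    unfolding tmap_def by (rule linear_tlift[OF vector_space_pm_scale])
  have m: "Vector_Spaces.linear pm_scale pm_scale (\<lambda>T. ?m T T')"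
    "Vector_Spaces.linear pm_scale pm_scale (?m T)" for T T'
    unfolding gtens_mult_def by (intro bundle_linear_intros)+
  have d: "Vector_Spaces.linear pm_scale pm_scale (gtens_dif \<Omega>A \<Omega>H)"
    unfolding gtens_dif_def by (intro bundle_linear_intros)
  have "?P (?m (tensW (incl \<Omega>A p) (incl \<Omega>H q)) (tensW (dif \<Omega>A (incl \<Omega>A x)) (incl \<Omega>H y) + tensW (incl \<Omega>A x) (dif \<Omega>H (incl \<Omega>H y))))
     = tensW (incl \<Omega>A (p * x)) (incl \<Omega>H q * dif \<Omega>H (incl \<Omega>H y))" for p q x y
  proof -
    have g: "incl \<Omega>A p * dif \<Omega>A (incl \<Omega>A x) \<in> grade \<Omega>A 1"
      "incl \<Omega>A p * incl \<Omega>A x \<in> grade \<Omega>A 0"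
      "incl \<Omega>H q * dif \<Omega>H (incl \<Omega>H y) \<in> grade \<Omega>H 1"
      using total.grade_mult[OF total.incl_in_grade total.dif_incl_in_grade]
        total.grade_mult[OF total.incl_in_grade total.incl_in_grade]
        forms.grade_mult[OF forms.incl_in_grade forms.dif_incl_in_grade] by auto
    have "?m (tensW (incl \<Omega>A p) (incl \<Omega>H q)) (tensW (dif \<Omega>A (incl \<Omega>A x)) (incl \<Omega>H y) + tensW (incl \<Omega>A x) (dif \<Omega>H (incl \<Omega>H y)))
      = tensW (incl \<Omega>A p * dif \<Omega>A (incl \<Omega>A x)) (incl \<Omega>H q * incl \<Omega>H y) +
        tensW (incl \<Omega>A p * incl \<Omega>A x) (incl \<Omega>H q * dif \<Omega>H (incl \<Omega>H y))"
      using m(2)[of "tensW (incl \<Omega>A p) (incl \<Omega>H q)"]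
        gtens_mult_homogeneous[OF forms.incl_in_grade total.dif_incl_in_grade]
        gtens_mult_homogeneous[OF forms.incl_in_grade total.incl_in_grade]
      by (simp add: Vector_Spaces.linear_iff pm_scale_one)
    then show ?thesis
      using P g by (simp add: Vector_Spaces.linear_iff tmap_tens[OF total.linear_hcomp forms.linear_hcomp] tens_zero_left
          total.vector_space_forms forms.vector_space_forms
          total.hcomp_homogeneous forms.hcomp_homogeneous total.incl_mult)
  qed
  then show ?thesis
    unfolding mixed_part_def ext_mult ext_dif ext_coact unfolding tmap_def[of _ _ "incl \<Omega>A"]
    unfolding linear_comp_tlift[OF d] gtens_dif_incl linear_comp_tlift[OF m(1)] linear_comp_tlift[OF P]
    unfolding linear_comp_tlift[OF m(2)] linear_comp_tlift[OF P] by simp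
qed

text \<open>
  The map \<open>a \<otimes> \<theta> \<mapsto> a\<^sub>0 \<otimes> a\<^sub>1 \<theta>\<close>, which takes \<open>\<pi>\<^sub>v \<omega>\<close> to the mixed part of \<open>\<omega>\<close>.  Its values are
  written in \<open>\<Omega>(A) \<otimes> \<Omega>(H)\<close>, with \<open>A\<close> embedded as degree 0, because mixed parts live there.
\<close>

definition unroll :: "('k,'a,'v) tensor \<Rightarrow> ('k,'w,'v) tensor" where
  "unroll = tlift pm_scale (\<lambda>a \<theta>. tlift pm_scale (\<lambda>x y. tensW (incl \<Omega>A x) (incl \<Omega>H y * \<theta>)) (coact A a))"

lemma linear_unroll: "Vector_Spaces.linear pm_scale pm_scale unroll"
  unfolding unroll_def by (rule linear_tlift[OF vector_space_pm_scale])

lemma unroll_tens: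
  "unroll (tensA a \<theta>) = tlift pm_scale (\<lambda>x y. tensW (incl \<Omega>A x) (incl \<Omega>H y * \<theta>)) (coact A a)"
  unfolding unroll_def by (rule tlift_tens_eq) (intro bundle_linear_intros)+

lemma unroll_one: "unroll (tensA 1 \<theta>) = tensW 1 \<theta>"
  unfolding unroll_tens comod.coact_one
  by (subst tlift_tens_eq) (auto intro!: bundle_linear_intros simp: total.incl_one forms.incl_one)

text \<open>
  The inverse is \<open>a \<otimes> \<theta> \<mapsto> a\<^sub>0 \<otimes> S(a\<^sub>1) \<theta>\<close>, as \<open>a\<^sub>0 \<otimes> S(a\<^sub>1) a\<^sub>2 \<theta> = a \<otimes> \<theta>\<close>.
\<close>

lemma unroll_left_inverse:
  "\<exists>R. \<forall>T\<in>tens_space (ascale A) (wscale \<Omega>H) UNIV UNIV. R (unroll T) = T"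
proof -
  interpret pair: vector_space_pair "ascale A" "wscale \<Omega>A"
    using comod.vector_space_bundle total.vector_space_forms by (simp add: vector_space_pair_def)
  \<comment> \<open>Coactions are defined on \<open>A\<close> and not on \<open>\<Omega>(A)\<close>, so a linear retraction of \<open>incl\<close> is needed.\<close>
  obtain j where j: "Vector_Spaces.linear (wscale \<Omega>A) (ascale A) j" and "j \<circ> incl \<Omega>A = id"
    using pair.linear_injective_left_inverse[OF total.incl_linear total.incl_inj] by blast
  then have j_incl: "j (incl \<Omega>A a) = a" for a by (metis comp_apply id_apply)
  note lin = bundle_linear_intros linear_after[OF j]
  define R where "R = tlift pm_scale (\<lambda>w \<eta>. tlift pm_scale
    (\<lambda>x y. tensA x (incl \<Omega>H (antipode H y) * \<eta>)) (coact A (j w)))"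
  have R: "Vector_Spaces.linear pm_scale pm_scale R"
    unfolding R_def by (rule linear_tlift[OF vector_space_pm_scale])
  have R_tens: "R (tensW (incl \<Omega>A a) \<eta>) = tlift pm_scale (\<lambda>x y. tensA x (incl \<Omega>H (antipode H y) * \<eta>)) (coact A a)" for a \<eta>
    unfolding R_def by (subst tlift_tens_eq) (auto intro!: lin simp: j_incl)
  have "R (unroll (tensA a \<theta>)) = tensA a \<theta>" for a \<theta>
  proof -
    have "R (unroll (tensA a \<theta>)) =
        tlift pm_scale (\<lambda>x y. tlift pm_scale (\<lambda>u v. tensA u (incl \<Omega>H (antipode H v) * (incl \<Omega>H y * \<theta>))) (coact A x)) (coact A a)"
      by (simp only: unroll_tens linear_comp_tlift[OF R] R_tens)
    also have "\<dots> = tlift pm_scale (\<lambda>x y. tlift pm_scale (\<lambda>u v. tensA x (incl \<Omega>H (antipode H u) * (incl \<Omega>H v * \<theta>))) (comult H y)) (coact A a)"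
      by (rule tlift_coact_coassoc) (intro lin)+
    also have "\<dots> = tlift pm_scale (\<lambda>x y. tlift pm_scale (\<lambda>u v. tensA x (incl \<Omega>H (antipode H u * v) * \<theta>)) (comult H y)) (coact A a)"
      by (simp only: forms.incl_mult mult.assoc)
    also have "\<dots> = tlift pm_scale (\<lambda>x y. pm_scale (counit H y) (tensA x \<theta>)) (coact A a)"
      by (subst tlift_antipode_left) (auto intro!: lin simp: forms.incl_one)
    also have "\<dots> = tensA a \<theta>"
      by (rule tlift_coact_counit) (intro lin)
    finally show ?thesis .
  qed
  then have "R (unroll T) = T" if "T \<in> tens_space (ascale A) (wscale \<Omega>H) UNIV UNIV" for T
    using that
    by (intro linear_eq_on_tens_space[OF that, where K = "\<lambda>T. R (unroll T)" and L = "\<lambda>T. T" and r = pm_scale]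
        linear_after[OF R] linear_unroll linear_self vector_space_pm_scale)
  then show ?thesis by blast
qed

text \<open>
  In Sweedler notation, \<open>unroll\<close> maps \<open>a a'\<^sub>0 \<otimes> S(a'\<^sub>1) da'\<^sub>2\<close> to
  \<open>a\<^sub>0 a'\<^sub>0 \<otimes> a\<^sub>1 a'\<^sub>1 S(a'\<^sub>2) da'\<^sub>3 = a\<^sub>0 a'\<^sub>0 \<otimes> a\<^sub>1 da'\<^sub>1\<close>.  The proof first brings the sum over
  \<open>a\<^sub>0 \<otimes> a\<^sub>1\<close> innermost, so that coassociativity can be applied to \<open>a'\<close> alone.
\<close>

lemma unroll_vert_elem:
  "unroll (vert_elem H \<Omega>H A a a') = mixed_part (incl \<Omega>A a * dif \<Omega>A (incl \<Omega>A a'))"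
proof -
  let ?i = "incl \<Omega>A" and ?j = "incl \<Omega>H" and ?S = "antipode H"
  let ?d = "\<lambda>y. dif \<Omega>H (incl \<Omega>H y)"
  note lin = bundle_linear_intros
  have "unroll (vert_elem H \<Omega>H A a a') = tlift pm_scale (\<lambda>x y. tlift pm_scale (\<lambda>y1 y2.
      tlift pm_scale (\<lambda>u v. tensW (?i u) (?j v * (?j (?S y1) * ?d y2))) (coact A (a * x))) (comult H y)) (coact A a')"
    by (simp only: vert_elem_def linear_comp_tlift[OF linear_unroll] unroll_tens)
  also have "\<dots> = tlift pm_scale (\<lambda>x y. tlift pm_scale (\<lambda>y1 y2. tlift pm_scale (\<lambda>p q. tlift pm_scale (\<lambda>u v.
      tensW (?i (p * u)) (?j (q * v) * (?j (?S y1) * ?d y2))) (coact A x)) (coact A a)) (comult H y)) (coact A a')"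
    unfolding comod.coact_mult by (subst tlift_tmult, (intro lin)+) simp
  also have "\<dots> = tlift pm_scale (\<lambda>x y. tlift pm_scale (\<lambda>u v. tlift pm_scale (\<lambda>y1 y2. tlift pm_scale (\<lambda>p q. 
      tensW (?i (p * u)) (?j (q * v) * (?j (?S y1) * ?d y2))) (coact A a)) (comult H y)) (coact A x)) (coact A a')"
  proof -
    have "tlift pm_scale (\<lambda>y1 y2. tlift pm_scale (\<lambda>p q. tlift pm_scale (\<lambda>u v. f u v p q y1 y2) T) T') T'' =
        tlift pm_scale (\<lambda>u v. tlift pm_scale (\<lambda>y1 y2. tlift pm_scale (\<lambda>p q. f u v p q y1 y2) T') T'') T"
      for f :: "'a \<Rightarrow> 'h \<Rightarrow> 'a \<Rightarrow> 'h \<Rightarrow> 'h \<Rightarrow> 'h \<Rightarrow> ('k,'w,'v) tensor" and T T' T''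
      by (subst tlift_swap[OF vector_space_pm_scale, of _ T], subst tlift_swap[OF vector_space_pm_scale, of _ T]) simp
    then show ?thesis by simp
  qed
  also have "\<dots> = tlift pm_scale (\<lambda>x y. tlift pm_scale (\<lambda>u v. tlift pm_scale (\<lambda>y1 y2. tlift pm_scale (\<lambda>p q. 
      tensW (?i (p * x)) (?j (q * u) * (?j (?S y1) * ?d y2))) (coact A a)) (comult H v)) (comult H y)) (coact A a')"
    by (rule tlift_coact_coassoc) (intro lin)+
  also have "\<dots> = tlift pm_scale (\<lambda>x y. tlift pm_scale (\<lambda>u v. tlift pm_scale (\<lambda>y1 y2. tlift pm_scale (\<lambda>p q. 
      tensW (?i (p * x)) (?j (q * y1) * (?j (?S y2) * ?d v))) (coact A a)) (comult H u)) (comult H y)) (coact A a')"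
    by (subst tlift_coassoc) (intro lin refl)+
  also have "\<dots> = tlift pm_scale (\<lambda>x y. tlift pm_scale (\<lambda>u v. tlift pm_scale (\<lambda>y1 y2. tlift pm_scale (\<lambda>p q. 
      tensW (?i (p * x)) (?j q * (?j (y1 * ?S y2) * ?d v))) (coact A a)) (comult H u)) (comult H y)) (coact A a')"
    by (simp only: forms.incl_mult mult.assoc)
  also have "\<dots> = tlift pm_scale (\<lambda>x y. tlift pm_scale (\<lambda>u v. pm_scale (counit H u) (tlift pm_scale (\<lambda>p q. 
      tensW (?i (p * x)) (?j q * ?d v)) (coact A a))) (comult H y)) (coact A a')"
    by (subst tlift_antipode_right) (auto intro!: lin simp: forms.incl_one)
  also have "\<dots> = tlift pm_scale (\<lambda>x y. tlift pm_scale (\<lambda>p q. 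
      tensW (?i (p * x)) (?j q * ?d y)) (coact A a)) (coact A a')"
    by (subst tlift_counit_left) (intro lin refl)+
  also have "\<dots> = mixed_part (incl \<Omega>A a * dif \<Omega>A (incl \<Omega>A a'))"
    unfolding mixed_part_form by (rule tlift_swap[OF vector_space_pm_scale])
  finally show ?thesis .
qed


lemma vert_elem_in_tens_space:
  "vert_elem H \<Omega>H A a a' \<in> tens_space (ascale A) (wscale \<Omega>H) UNIV UNIV"
proof -
  interpret P: vector_space "pm_scale :: 'k \<Rightarrow> ('k,'a,'v) tensor \<Rightarrow> _" by (rule vector_space_pm_scale)
  show ?thesis
    unfolding vert_elem_def tens_space_def
    by (intro tlift_subspace P.vector_space_axioms P.subspace_span P.span_base) auto
qed

text \<open>
  The vertical projection is well defined: whatever presentation \<open>\<Sum> a da'\<close> of \<open>\<omega>\<close> is chosen, \<open>unroll\<close>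
  maps the resulting tensor to the mixed part of \<open>\<omega>\<close>, and \<open>unroll\<close> is injective.
\<close>

lemma
  assumes "\<omega> \<in> grade \<Omega>A 1"
  shows unroll_pi_v: "unroll (pi_v H \<Omega>H A \<Omega>A \<omega>) = mixed_part \<omega>"
    and pi_v_in_tens_space: "pi_v H \<Omega>H A \<Omega>A \<omega> \<in> tens_space (ascale A) (wscale \<Omega>H) UNIV UNIV"
proof -
  interpret P: vector_space "pm_scale :: 'k \<Rightarrow> ('k,'a,'v) tensor \<Rightarrow> _" by (rule vector_space_pm_scale)
  interpret U: Vector_Spaces.linear pm_scale pm_scale unroll by (rule linear_unroll)
  interpret M: Vector_Spaces.linear "wscale \<Omega>A" pm_scale mixed_part by (rule linear_mixed_part)
  let ?T = "tens_space (ascale A) (wscale \<Omega>H) UNIV UNIV"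
  let ?rep = "\<lambda>T. \<exists>(n::nat) a a'.
     \<omega> = (\<Sum>i<n. incl \<Omega>A (a i) * dif \<Omega>A (incl \<Omega>A (a' i))) \<and>
     T = (\<Sum>i<n. vert_elem H \<Omega>H A (a i) (a' i))"
  have rep: "unroll T = mixed_part \<omega> \<and> T \<in> ?T" if "?rep T" for T
    using that vert_elem_in_tens_space
    by (auto simp: U.sum M.sum unroll_vert_elem tens_space_def intro!: P.span_sum)
  obtain R where R: "\<And>T. T \<in> ?T \<Longrightarrow> R (unroll T) = T"
    using unroll_left_inverse by blast
  obtain T where T: "?rep T"
    using total.one_forms_are_sums[OF assms] by blast
  have "T' = T" if "?rep T'" for T'
    using rep[OF T] rep[OF that] R by metis
  then have "pi_v H \<Omega>H A \<Omega>A \<omega> = T"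
    unfolding pi_v_def using T by (intro the_equality)
  then show "unroll (pi_v H \<Omega>H A \<Omega>A \<omega>) = mixed_part \<omega>" "pi_v H \<Omega>H A \<Omega>A \<omega> \<in> ?T"
    using rep[OF T] by simp_all
qed

lemma pi_v_eqI:
  assumes "\<omega> \<in> grade \<Omega>A 1" "\<eta> \<in> grade \<Omega>A 1" "mixed_part \<omega> = mixed_part \<eta>"
  shows "pi_v H \<Omega>H A \<Omega>A \<omega> = pi_v H \<Omega>H A \<Omega>A \<eta>"
  using unroll_left_inverse unroll_pi_v pi_v_in_tens_space assms by metis

section \<open>Graded vertical automorphisms\<close>

text \<open>
  The identity \<open>id \<otimes> id = id\<close> holds on the span of the elementary tensors but not on all formal sums.
  This membership makes it available on the values of \<open>\<Delta>\<close>, as the identity automorphism and inverses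
  require.
\<close>

lemma ext_in_tens_space: "\<Delta> \<omega> \<in> tens_space (wscale \<Omega>A) (wscale \<Omega>H) UNIV UNIV"
proof -
  interpret P: vector_space "pm_scale :: 'k \<Rightarrow> ('k,'w,'v) tensor \<Rightarrow> _" by (rule vector_space_pm_scale)
  interpret D: Vector_Spaces.linear "wscale \<Omega>A" pm_scale \<Delta> by (rule ext_linear)
  have "gtens_grade \<Omega>A \<Omega>H n \<subseteq> tens_space (wscale \<Omega>A) (wscale \<Omega>H) UNIV UNIV" for n
    unfolding gtens_grade_def tens_space_def by (rule P.span_mono) auto
  then have "\<Delta> (hcomp (grade \<Omega>A) n \<omega>) \<in> tens_space (wscale \<Omega>A) (wscale \<Omega>H) UNIV UNIV" for n
    using ext_grade[OF total.hcomp_in_grade] by blast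
  then have "\<Delta> (\<Sum>n\<in>{n. hcomp (grade \<Omega>A) n \<omega> \<noteq> 0}. hcomp (grade \<Omega>A) n \<omega>)
      \<in> tens_space (wscale \<Omega>A) (wscale \<Omega>H) UNIV UNIV"
    unfolding D.sum tens_space_def by (intro P.span_sum)
  then show ?thesis by (simp only: total.sum_hcomp)
qed

lemma vertical_autsD:
  assumes "F \<in> vertical_auts \<Omega>H \<Omega>A \<Delta>"
  shows "Vector_Spaces.linear (wscale \<Omega>A) (wscale \<Omega>A) F"
    and "\<omega> \<in> grade \<Omega>A n \<Longrightarrow> F \<omega> \<in> grade \<Omega>A n"
    and "\<beta> \<in> basic_forms \<Omega>H \<Omega>A \<Delta> \<Longrightarrow> F (\<beta> * \<omega>) = \<beta> * F \<omega>"
    and "bij F" and "F 1 = 1"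
    and "\<Delta> (F \<omega>) = tmap (wscale \<Omega>A) (wscale \<Omega>H) F (\<lambda>y. y) (\<Delta> \<omega>)"
  using assms unfolding vertical_auts_def id_def by blast+

lemma hcomp_commute:
  assumes F: "F \<in> vertical_auts \<Omega>H \<Omega>A \<Delta>"
  shows "hcomp (grade \<Omega>A) n (F \<omega>) = F (hcomp (grade \<Omega>A) n \<omega>)"
proof -
  interpret F: Vector_Spaces.linear "wscale \<Omega>A" "wscale \<Omega>A" F by (rule vertical_autsD(1)[OF F])
  show ?thesis
    by (rule total.hcomp_eq_sumI[OF total.finite_hcomp[of \<omega>]])
      (auto simp: F.zero total.sum_hcomp vertical_autsD(2)[OF F] total.hcomp_in_grade simp flip: F.sum)
qed

text \<open>
  The common source of covariance (\<open>m = 1\<close>, \<open>n = 0\<close>) and of verticality (\<open>m = 0\<close>, \<open>n = 1\<close>).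
\<close>

lemma components_ext_commute:
  assumes F: "F \<in> vertical_auts \<Omega>H \<Omega>A \<Delta>"
  shows "tmap (wscale \<Omega>A) (wscale \<Omega>H) (hcomp (grade \<Omega>A) m) (hcomp (grade \<Omega>H) n) (\<Delta> (F \<omega>)) =
    tmap (wscale \<Omega>A) (wscale \<Omega>H) F (\<lambda>y. y)
      (tmap (wscale \<Omega>A) (wscale \<Omega>H) (hcomp (grade \<Omega>A) m) (hcomp (grade \<Omega>H) n) (\<Delta> \<omega>))"
  unfolding vertical_autsD(6)[OF F]
  by (simp only: tmap_tmap[OF total.linear_hcomp forms.linear_hcomp]
      tmap_tmap[OF vertical_autsD(1)[OF F] linear_self[OF forms.vector_space_forms]] hcomp_commute[OF F])

section \<open>Connections and curvature under vertical automorphisms\<close>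

lemma aut_act_in_connections:
  assumes F: "F \<in> vertical_auts \<Omega>H \<Omega>A \<Delta>" and s: "s \<in> connections H \<Omega>H lco A \<Omega>A \<Delta>"
  shows "aut_act H \<Omega>H lco F s \<in> connections H \<Omega>H lco A \<Omega>A \<Delta>"
proof -
  interpret F: Vector_Spaces.linear "wscale \<Omega>A" "wscale \<Omega>A" F by (rule vertical_autsD(1)[OF F])
  interpret l: Vector_Spaces.linear "wscale \<Omega>H" pm_scale lco by (rule lco_linear)
  let ?L = "Lambda1 H \<Omega>H lco" and ?s = "aut_act H \<Omega>H lco F s"
  let ?F = "tmap (wscale \<Omega>A) (wscale \<Omega>H) F (\<lambda>y. y)"
  have F_tens: "?F (tensW \<omega> \<theta>) = tensW (F \<omega>) \<theta>" for \<omega> \<theta>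
    by (rule tmap_tens[OF vertical_autsD(1)[OF F] linear_self[OF forms.vector_space_forms]])
  have act: "?s \<theta> = F (s \<theta>)" if "\<theta> \<in> ?L" for \<theta>
    using that by (simp add: aut_act_def compose_def)
  have s_grade: "s \<theta> \<in> grade \<Omega>A 1" if "\<theta> \<in> ?L" for \<theta>
    using s that unfolding connections_def by blast
  have sub: "\<theta> + \<theta>' \<in> ?L" "wscale \<Omega>H c \<theta> \<in> ?L" if "\<theta> \<in> ?L" "\<theta>' \<in> ?L" for \<theta> \<theta>' c
    using that forms.W.subspace_add[OF forms.grade_subspace] forms.W.subspace_scale[OF forms.grade_subspace]
      bilinear_tens[OF vector_space_hopf forms.vector_space_forms]
    unfolding Lambda1_def bilinear_map_def Vector_Spaces.linear_iff by (auto simp: l.add l.scale)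
  have one_forms: "?s \<in> ?L \<rightarrow>\<^sub>E grade \<Omega>A 1"
    using s_grade vertical_autsD(2)[OF F] by (auto simp: aut_act_def compose_def)
  have add: "?s (\<theta> + \<theta>') = ?s \<theta> + ?s \<theta>'" if "\<theta> \<in> ?L" "\<theta>' \<in> ?L" for \<theta> \<theta>'
    using s that sub[OF that] unfolding connections_def by (simp add: act F.add)
  have scale: "?s (wscale \<Omega>H c \<theta>) = wscale \<Omega>A c (?s \<theta>)" if "\<theta> \<in> ?L" for \<theta> c
    using s that sub[OF that that] unfolding connections_def by (simp add: act F.scale)
  have covariant: "coact1 \<Omega>H \<Omega>A \<Delta> (?s (cartan_maurer H \<Omega>H h)) =
        tlift pm_scale (\<lambda>x h3. tlift pm_scale (\<lambda>h1 h2.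
          tensW (?s (cartan_maurer H \<Omega>H (pi_eps H h2))) (incl \<Omega>H (antipode H h1 * h3)))
          (comult H x)) (comult H h)" if "h \<in> Hplus H" for h
  proof -
    have push: "?F (tlift pm_scale f T) = tlift pm_scale (\<lambda>x y. ?F (f x y)) T" for f and T :: "('k,'h,'h) tensor"
      unfolding tmap_def by (rule linear_comp_tlift[OF linear_tlift[OF vector_space_pm_scale]])
    have "coact1 \<Omega>H \<Omega>A \<Delta> (?s (cartan_maurer H \<Omega>H h)) = ?F (coact1 \<Omega>H \<Omega>A \<Delta> (s (cartan_maurer H \<Omega>H h)))"
      unfolding act[OF cartan_maurer_in_Lambda1] coact1_def by (rule components_ext_commute[OF F])
    also have "coact1 \<Omega>H \<Omega>A \<Delta> (s (cartan_maurer H \<Omega>H h)) =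
        tlift pm_scale (\<lambda>x h3. tlift pm_scale (\<lambda>h1 h2.
          tensW (s (cartan_maurer H \<Omega>H (pi_eps H h2))) (incl \<Omega>H (antipode H h1 * h3)))
          (comult H x)) (comult H h)"
      using s that unfolding connections_def by blast
    finally show ?thesis
      by (simp only: push F_tens act[OF cartan_maurer_in_Lambda1])
  qed
  have vertical: "pi_v H \<Omega>H A \<Omega>A (?s \<theta>) = tensA 1 \<theta>" if "\<theta> \<in> ?L" for \<theta>
  proof -
    have pi: "pi_v H \<Omega>H A \<Omega>A (s \<theta>) = tensA 1 \<theta>"
      using s that unfolding connections_def by blast
    have mixed: "mixed_part (s \<theta>) = tensW 1 \<theta>"
      using unroll_pi_v[OF s_grade[OF that]] by (simp add: pi unroll_one)
    have "mixed_part (F (s \<theta>)) = ?F (mixed_part (s \<theta>))"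
      unfolding mixed_part_def by (rule components_ext_commute[OF F])
    also have "\<dots> = tensW 1 \<theta>"
      by (simp only: mixed F_tens vertical_autsD(5)[OF F])
    finally have "pi_v H \<Omega>H A \<Omega>A (F (s \<theta>)) = pi_v H \<Omega>H A \<Omega>A (s \<theta>)"
      by (intro pi_v_eqI vertical_autsD(2)[OF F] s_grade that) (simp add: mixed)
    then show ?thesis by (simp add: act that pi)
  qed
  show ?thesis
    unfolding connections_def using one_forms add scale covariant vertical by simp
qed

lemma curvature_aut_act:
  "curvature H \<Omega>H \<Omega>A (aut_act H \<Omega>H lco F s) h = dif \<Omega>A (F (s (cartan_maurer H \<Omega>H h))) +
     tlift (wscale \<Omega>A) (\<lambda>h1 h2.
       F (s (cartan_maurer H \<Omega>H (pi_eps H h1))) * F (s (cartan_maurer H \<Omega>H (pi_eps H h2)))) (comult H h)"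
  unfolding curvature_def aut_act_def compose_def by (simp add: cartan_maurer_in_Lambda1)

lemma dga_endomorphism_curvature:
  assumes "dga_endomorphism \<Omega>A F"
  shows "F (curvature H \<Omega>H \<Omega>A s h) = curvature H \<Omega>H \<Omega>A (aut_act H \<Omega>H lco F s) h"
proof -
  have F: "Vector_Spaces.linear (wscale \<Omega>A) (wscale \<Omega>A) F" and mult: "F (x * y) = F x * F y"
    and dif: "F (dif \<Omega>A x) = dif \<Omega>A (F x)" for x y
    using assms unfolding dga_endomorphism_def by blast+
  interpret F: Vector_Spaces.linear "wscale \<Omega>A" "wscale \<Omega>A" F by (rule F)
  show ?thesis
    unfolding curvature_aut_act unfolding curvature_def F.add linear_comp_tlift[OF F] mult dif ..
qed

section \<open>The group of vertical automorphisms and its action\<close>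

lemma id_in_vertical_auts: "id \<in> vertical_auts \<Omega>H \<Omega>A \<Delta>"
  using tmap_id[OF total.vector_space_forms forms.vector_space_forms ext_in_tens_space]
    linear_self[OF total.vector_space_forms]
  by (simp add: vertical_auts_def id_def bij_id[unfolded id_def])

lemma comp_in_vertical_auts:
  assumes F: "F \<in> vertical_auts \<Omega>H \<Omega>A \<Delta>" and G: "G \<in> vertical_auts \<Omega>H \<Omega>A \<Delta>"
  shows "F \<circ> G \<in> vertical_auts \<Omega>H \<Omega>A \<Delta>"
proof -
  have "\<Delta> (F (G \<omega>)) = tmap (wscale \<Omega>A) (wscale \<Omega>H) (F \<circ> G) id (\<Delta> \<omega>)" for \<omega>
    unfolding vertical_autsD(6)[OF F] vertical_autsD(6)[OF G]
      tmap_tmap[OF vertical_autsD(1)[OF F] linear_self[OF forms.vector_space_forms]] by (simp add: comp_def id_def)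
  moreover have "Vector_Spaces.linear (wscale \<Omega>A) (wscale \<Omega>A) (F \<circ> G)"
    using linear_after[OF vertical_autsD(1)[OF F] vertical_autsD(1)[OF G]] by (simp add: comp_def)
  moreover have "bij (F \<circ> G)"
    by (intro bij_comp vertical_autsD(4) F G)
  ultimately show ?thesis
    unfolding vertical_auts_def using vertical_autsD(2,3,5)[OF F] vertical_autsD(2,3,5)[OF G]
    by (simp add: image_subset_iff)
qed

text \<open>
  That the inverse preserves degrees uses that \<open>F\<close> commutes with homogeneous components: if \<open>\<omega>\<close> has
  degree \<open>n\<close>, then \<open>F\<close> maps the degree \<open>n\<close> component of \<open>F\<^sup>-\<^sup>1 \<omega>\<close> to \<open>\<omega>\<close>, so this component is all of
  \<open>F\<^sup>-\<^sup>1 \<omega>\<close>.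
\<close>

lemma inv_in_vertical_auts:
  assumes F: "F \<in> vertical_auts \<Omega>H \<Omega>A \<Delta>"
  shows "inv_into UNIV F \<in> vertical_auts \<Omega>H \<Omega>A \<Delta>"
proof -
  interpret F: Vector_Spaces.linear "wscale \<Omega>A" "wscale \<Omega>A" F by (rule vertical_autsD(1)[OF F])
  have FG: "F (inv_into UNIV F \<omega>) = \<omega>" and GF: "inv_into UNIV F (F \<omega>) = \<omega>" for \<omega>
    using vertical_autsD(4)[OF F] by (simp_all add: bij_is_surj bij_is_inj surj_f_inv_f)
  have eqI: "inv_into UNIV F \<omega> = \<eta>" if "F \<eta> = \<omega>" for \<omega> \<eta>
    using that GF by blast
  have lin: "Vector_Spaces.linear (wscale \<Omega>A) (wscale \<Omega>A) (inv_into UNIV F)"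
    unfolding Vector_Spaces.linear_iff using total.vector_space_forms
    by (auto intro!: eqI simp: F.add F.scale FG)
  moreover have "inv_into UNIV F \<omega> \<in> grade \<Omega>A n" if "\<omega> \<in> grade \<Omega>A n" for \<omega> n
  proof -
    have "F (hcomp (grade \<Omega>A) n (inv_into UNIV F \<omega>)) = \<omega>"
      using that by (simp add: FG total.hcomp_homogeneous flip: hcomp_commute[OF F])
    then have "inv_into UNIV F \<omega> = hcomp (grade \<Omega>A) n (inv_into UNIV F \<omega>)" by (rule eqI)
    then show ?thesis using total.hcomp_in_grade by metis
  qed
  moreover have "inv_into UNIV F (\<beta> * \<omega>) = \<beta> * inv_into UNIV F \<omega>" if "\<beta> \<in> basic_forms \<Omega>H \<Omega>A \<Delta>" for \<beta> \<omega>
    by (rule eqI) (simp add: vertical_autsD(3)[OF F that] FG)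
  moreover have "inv_into UNIV F 1 = 1" by (rule eqI) (rule vertical_autsD(5)[OF F])
  moreover have "\<Delta> (inv_into UNIV F \<omega>) = tmap (wscale \<Omega>A) (wscale \<Omega>H) (inv_into UNIV F) id (\<Delta> \<omega>)" for \<omega>
  proof -
    have "\<Delta> (inv_into UNIV F \<omega>) = tmap (wscale \<Omega>A) (wscale \<Omega>H) (inv_into UNIV F) (\<lambda>y. y)
        (tmap (wscale \<Omega>A) (wscale \<Omega>H) F (\<lambda>y. y) (\<Delta> (inv_into UNIV F \<omega>)))"
      unfolding tmap_tmap[OF lin linear_self[OF forms.vector_space_forms]] GF
      by (rule tmap_id[OF total.vector_space_forms forms.vector_space_forms ext_in_tens_space, symmetric])
    also have "\<dots> = tmap (wscale \<Omega>A) (wscale \<Omega>H) (inv_into UNIV F) (\<lambda>y. y) (\<Delta> \<omega>)"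
      by (simp only: FG flip: vertical_autsD(6)[OF F])
    finally show ?thesis by (simp add: id_def)
  qed
  ultimately show ?thesis
    unfolding vertical_auts_def using bij_imp_bij_inv[OF vertical_autsD(4)[OF F]] by blast
qed

lemma group_vertical_auts: "group (vertical_aut_group \<Omega>H \<Omega>A \<Delta>)"
proof (rule groupI)
  fix F assume F: "F \<in> carrier (vertical_aut_group \<Omega>H \<Omega>A \<Delta>)"
  then have "F \<circ> inv_into UNIV F = id"
    by (auto simp: vertical_aut_group_def surj_iff[symmetric] dest!: vertical_autsD(4) bij_is_surj)
  then show "\<exists>G\<in>carrier (vertical_aut_group \<Omega>H \<Omega>A \<Delta>).
      G \<otimes>\<^bsub>vertical_aut_group \<Omega>H \<Omega>A \<Delta>\<^esub> F = \<one>\<^bsub>vertical_aut_group \<Omega>H \<Omega>A \<Delta>\<^esub>"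
    using F inv_in_vertical_auts by (auto simp: vertical_aut_group_def)
qed (auto simp: vertical_aut_group_def comp_in_vertical_auts id_in_vertical_auts comp_assoc)

lemma aut_act_comp:
  "aut_act H \<Omega>H lco F (aut_act H \<Omega>H lco G s) = aut_act H \<Omega>H lco (F \<circ> G) s"
  by (simp add: aut_act_def compose_def comp_def cong: restrict_cong)

text \<open>
  Connection 1-forms are \<open>undefined\<close> outside \<open>\<Lambda>\<^sup>1\<close>, so restricting to \<open>\<Lambda>\<^sup>1\<close> does not change them.
\<close>

lemma aut_act_id: "s \<in> connections H \<Omega>H lco A \<Omega>A \<Delta> \<Longrightarrow> aut_act H \<Omega>H lco id s = s"
  unfolding connections_def aut_act_def compose_def by (auto simp: PiE_restrict)

lemma right_group_action_connections:
  "right_group_action (vertical_aut_group \<Omega>H \<Omega>A \<Delta>) (connections H \<Omega>H lco A \<Omega>A \<Delta>) (aut_act H \<Omega>H lco)"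
proof -
  let ?G = "vertical_aut_group \<Omega>H \<Omega>A \<Delta>" and ?E = "connections H \<Omega>H lco A \<Omega>A \<Delta>"
  let ?a = "aut_act H \<Omega>H lco"
  interpret G: group ?G by (rule group_vertical_auts)
  have op: "group (opposite_group ?G)"
    by (rule groupI) (auto simp: opposite_group_def G.m_assoc intro: G.r_inv G.inv_closed)
  have "restrict (?a F) ?E \<in> Bij ?E" if F: "F \<in> vertical_auts \<Omega>H \<Omega>A \<Delta>" for F
  proof -
    have "F \<circ> inv_into UNIV F = id" "inv_into UNIV F \<circ> F = id"
      using vertical_autsD(4)[OF F] by (simp_all add: bij_is_surj bij_is_inj surj_iff[symmetric])
    then have "bij_betw (?a F) ?E ?E"
      using aut_act_in_connections[OF F] aut_act_in_connections[OF inv_in_vertical_auts[OF F]]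
      by (intro bij_betw_byWitness[where f' = "?a (inv_into UNIV F)"]) (auto simp: aut_act_comp aut_act_id)
    then show ?thesis by (simp add: Bij_def)
  qed
  moreover have "restrict (?a (F \<circ> G)) ?E = compose ?E (restrict (?a F) ?E) (restrict (?a G) ?E)"
    if "G \<in> vertical_auts \<Omega>H \<Omega>A \<Delta>" for F G
    using aut_act_in_connections[OF that] by (auto simp: compose_def aut_act_comp)
  ultimately have "(\<lambda>F. restrict (?a F) ?E) \<in> hom (opposite_group ?G) (BijGroup ?E)"
    by (intro homI) (simp_all add: opposite_group_def vertical_aut_group_def BijGroup_def)
  with op show ?thesis
    unfolding right_group_action_def group_action_def group_hom_def group_hom_axioms_def
    using group_BijGroup G.group_axioms by blast
qed

end


theorem proposition4p9:
  fixes H :: "('k::field, 'h::{ring,monoid_mult}) hopf_struct"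
    and \<Omega>H :: "('k, 'h, 'v::{ring,monoid_mult}) calc_struct"
    and lco :: "'v \<Rightarrow> ('k,'h,'v) tensor"
    and rco :: "'v \<Rightarrow> ('k,'v,'h) tensor"
    and A :: "('k, 'h, 'a::{ring,monoid_mult}) comod_struct"
    and \<Omega>A :: "('k, 'a, 'w::{ring,monoid_mult}) calc_struct"
    and \<Delta> :: "'w \<Rightarrow> ('k,'w,'v) tensor"
  assumes "hopf_algebra H" and "bij (antipode H)"
    and "differential_calculus (hscale H) \<Omega>H"
    and "bicovariant_calculus H \<Omega>H lco rco"
    and "maximal_prolongation (hscale H) \<Omega>H"
    and "quantum_principal_bundle H A"
    and "complete_calculus \<Omega>H A \<Omega>A \<Delta>"
  shows "(\<forall>F\<in>vertical_auts \<Omega>H \<Omega>A \<Delta>. \<forall>s\<in>connections H \<Omega>H lco A \<Omega>A \<Delta>.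
            aut_act H \<Omega>H lco F s \<in> connections H \<Omega>H lco A \<Omega>A \<Delta> \<and>
            (\<forall>h\<in>Hplus H. curvature H \<Omega>H \<Omega>A (aut_act H \<Omega>H lco F s) h =
               dif \<Omega>A (F (s (cartan_maurer H \<Omega>H h))) +
               tlift (wscale \<Omega>A) (\<lambda>h1 h2.
                 F (s (cartan_maurer H \<Omega>H (pi_eps H h1))) * F (s (cartan_maurer H \<Omega>H (pi_eps H h2))))
                 (comult H h)) \<and>
            (dga_endomorphism \<Omega>A F \<longrightarrow>
               (\<forall>h\<in>Hplus H. F (curvature H \<Omega>H \<Omega>A s h) =
                  curvature H \<Omega>H \<Omega>A (aut_act H \<Omega>H lco F s) h))) \<and>
         right_group_action (vertical_aut_group \<Omega>H \<Omega>A \<Delta>) (connections H \<Omega>H lco A \<Omega>A \<Delta>)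
           (aut_act H \<Omega>H lco)"
proof -
  interpret hopf_algebra H by fact
  interpret forms: differential_calculus "hscale H" \<Omega>H by fact
  interpret bicovariant_calculus H \<Omega>H lco rco by fact
  interpret comod: comodule_algebra H A
    using assms(6) by (simp add: quantum_principal_bundle_def)
  interpret complete_calculus \<Omega>H A \<Omega>A \<Delta> by fact
  interpret total: differential_calculus "ascale A" \<Omega>A by (rule calculus)
  interpret complete_bundle H \<Omega>H lco rco A \<Omega>A \<Delta> by unfold_locales
  show ?thesis
    using aut_act_in_connections curvature_aut_act dga_endomorphism_curvature
      right_group_action_connections by blast
qed

end
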